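(* For every integer $n \ge 3$, $\tilde H_{\nu_n}(M_n) \neq 0$; and for all positive integers $m,n$ with $m+n\ge 3$, $\tilde H_{\nu_{m,n}}(M_{m,n}) \neq 0$.
   Context: $[n]=\{1,\dots,n\}$, $[n]'=\{1',\dots,n'\}$. The matching complex $M_n$ is the abstract simplicial complex whose vertices are the edges of the complete graph on $[n]$ and whose faces are the sets of pairwise disjoint edges (matchings). The chessboard complex $M_{m,n}$ is the abstract simplicial complex whose vertices are the edges of the complete bipartite graph with parts $[m]$ and $[n]'$ and whose faces are the sets of pairwise disjoint edges. $\nu_n = \lfloor \frac{n+1}{3}\rfloor - 1$ and $\nu_{m,n} = \min\{m,n,\lfloor \frac{m+n+1}{3}\rfloor\}-1$. $\tilde H_*$ denotes reduced simplicial homology with integer coefficients. *)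

theory Defs
  imports Complex_Main "HOL-Algebra.Free_Abelian_Groups"
begin

section \<open>Reduced simplicial homology with integer coefficients\<close>

text \<open>Abstract simplicial complexes are sets of finite faces; the empty face is included
  (it spans the chain group in degree -1, as reduced homology requires).\<close>

definition simplicial_complex :: "'a set set \<Rightarrow> bool" where
  "simplicial_complex K \<longleftrightarrow> (\<forall>\<sigma>\<in>K. finite \<sigma> \<and> (\<forall>\<tau>. \<tau> \<subseteq> \<sigma> \<longrightarrow> \<tau> \<in> K))"

definition simplicial_chain_group :: "'a set set \<Rightarrow> int \<Rightarrow> ('a set \<Rightarrow>\<^sub>0 int) monoid" where
  "simplicial_chain_group K d = free_Abelian_group {\<sigma> \<in> K. finite \<sigma> \<and> int (card \<sigma>) = d + 1}"

text \<open>Faces are oriented by a linear order \<open>r\<close> on the vertices. If the vertices of \<open>\<sigma>\<close> are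
  \<open>v\<^sub>0 < \<dots> < v\<^sub>d\<close> then the exponent below at \<open>v = v\<^sub>i\<close> is \<open>i\<close>, so this is the usual alternating sum
  of the facets of \<open>\<sigma>\<close>. In particular \<open>{v}\<close> is sent to the empty face (the augmentation) and the
  empty face to 0.\<close>

definition simplicial_boundary :: "'a rel \<Rightarrow> ('a set \<Rightarrow>\<^sub>0 int) \<Rightarrow> ('a set \<Rightarrow>\<^sub>0 int)" where
  "simplicial_boundary r =
     frag_extend (\<lambda>\<sigma>. \<Sum>v\<in>\<sigma>. frag_cmul ((-1) ^ card {u \<in> \<sigma>. (u, v) \<in> r - Id}) (frag_of (\<sigma> - {v})))"

definition simplicial_cycles :: "'a rel \<Rightarrow> 'a set set \<Rightarrow> int \<Rightarrow> ('a set \<Rightarrow>\<^sub>0 int) set" where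
  "simplicial_cycles r K d =
     {c \<in> carrier (simplicial_chain_group K d). simplicial_boundary r c = 0}"

definition simplicial_boundaries :: "'a rel \<Rightarrow> 'a set set \<Rightarrow> int \<Rightarrow> ('a set \<Rightarrow>\<^sub>0 int) set" where
  "simplicial_boundaries r K d =
     simplicial_boundary r ` carrier (simplicial_chain_group K (d + 1))"

definition reduced_homology_group ::
    "'a rel \<Rightarrow> 'a set set \<Rightarrow> int \<Rightarrow> ('a set \<Rightarrow>\<^sub>0 int) set monoid" where
  "reduced_homology_group r K d =
     subgroup_generated (simplicial_chain_group K d) (simplicial_cycles r K d)
       Mod simplicial_boundaries r K d"


subsection \<open>The homology groups are well-defined abelian groups\<close>

lemma simplicial_boundary_diff:
  "simplicial_boundary r (a - b) = simplicial_boundary r a - simplicial_boundary r b"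
  by (simp add: simplicial_boundary_def frag_extend_diff)

lemma simplicial_boundary_of:
  "simplicial_boundary r (frag_of \<sigma>) =
     (\<Sum>v\<in>\<sigma>. frag_cmul ((-1) ^ card {u \<in> \<sigma>. (u, v) \<in> r - Id}) (frag_of (\<sigma> - {v})))"
  by (simp add: simplicial_boundary_def)

lemma simplicial_boundary_boundary_of:
  assumes r: "linear_order_on V r" and \<sigma>: "finite \<sigma>" "\<sigma> \<subseteq> V"
  shows "simplicial_boundary r (simplicial_boundary r (frag_of \<sigma>)) = 0"
proof -
  define s :: "'a set \<Rightarrow> 'a \<Rightarrow> int" where "s = (\<lambda>\<sigma> v. (-1) ^ card {u \<in> \<sigma>. (u, v) \<in> r - Id})"
  define f where "f = (\<lambda>v w. frag_cmul (s \<sigma> v * s (\<sigma> - {v}) w) (frag_of (\<sigma> - {v} - {w})))"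
  define P where "P = (SIGMA v:\<sigma>. \<sigma> - {v})"
  have total: "total_on V r" and antisym: "antisym r"
    using r by (auto simp: linear_order_on_def partial_order_on_def)
  have sign: "s \<sigma> v * s (\<sigma> - {v}) w = - (s \<sigma> w * s (\<sigma> - {w}) v)"
    if "v \<in> \<sigma>" "w \<in> \<sigma>" "(v, w) \<in> r" "v \<noteq> w" for v w
  proof -
    have 1: "{u \<in> \<sigma>. (u, w) \<in> r - Id} = insert v {u \<in> \<sigma> - {v}. (u, w) \<in> r - Id}"
      using that by auto
    have "card {u \<in> \<sigma>. (u, w) \<in> r - Id} = Suc (card {u \<in> \<sigma> - {v}. (u, w) \<in> r - Id})"
      unfolding 1 using \<sigma> by (subst card_insert_disjoint) auto
    then have 2: "s \<sigma> w = - s (\<sigma> - {v}) w"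
      by (simp add: s_def)
    have "{u \<in> \<sigma> - {w}. (u, v) \<in> r - Id} = {u \<in> \<sigma>. (u, v) \<in> r - Id}"
      using that antisymD[OF antisym] by blast
    then have "s (\<sigma> - {w}) v = s \<sigma> v"
      by (simp add: s_def)
    with 2 show ?thesis by simp
  qed
  have anti: "f v w = - f w v" if vw: "(v, w) \<in> P" for v w
  proof -
    have mem: "v \<in> \<sigma>" "w \<in> \<sigma>" "v \<noteq> w"
      using vw by (auto simp: P_def)
    then have "(v, w) \<in> r \<or> (w, v) \<in> r"
      using total \<sigma> by (auto simp: total_on_def)
    then have "s \<sigma> v * s (\<sigma> - {v}) w = - (s \<sigma> w * s (\<sigma> - {w}) v)"
      using sign[of v w] sign[of w v] mem by auto
    moreover have "\<sigma> - {v} - {w} = \<sigma> - {w} - {v}" by auto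
    ultimately show ?thesis by (simp add: f_def)
  qed
  have "simplicial_boundary r (simplicial_boundary r (frag_of \<sigma>)) = (\<Sum>v\<in>\<sigma>. \<Sum>w\<in>\<sigma> - {v}. f v w)"
    unfolding simplicial_boundary_of
    unfolding simplicial_boundary_def
    by (simp add: frag_extend_sum[OF \<sigma>(1)] frag_extend_cmul f_def s_def
        frag_cmul_sum comp_def)
  also have "\<dots> = (\<Sum>p\<in>P. f (fst p) (snd p))"
    using \<sigma> by (simp add: P_def sum.Sigma case_prod_beta)
  finally have eq: "simplicial_boundary r (simplicial_boundary r (frag_of \<sigma>))
      = (\<Sum>p\<in>P. f (fst p) (snd p))" .
  have "(\<Sum>p\<in>P. f (fst p) (snd p)) = (\<Sum>p\<in>P. f (snd p) (fst p))"
    by (rule sum.reindex_bij_witness[of _ prod.swap prod.swap]) (auto simp: P_def)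
  also have "\<dots> = (\<Sum>p\<in>P. - f (fst p) (snd p))"
  proof (rule sum.cong)
    fix p assume "p \<in> P"
    then have "f (fst p) (snd p) = - f (snd p) (fst p)" using anti[of "fst p" "snd p"] by simp
    then show "f (snd p) (fst p) = - f (fst p) (snd p)" by simp
  qed simp
  also have "\<dots> = - (\<Sum>p\<in>P. f (fst p) (snd p))"
    by (rule sum_negf)
  finally have self: "(\<Sum>p\<in>P. f (fst p) (snd p)) = - (\<Sum>p\<in>P. f (fst p) (snd p))" .
  have "x = 0" if "x = - x" for x :: "'a set \<Rightarrow>\<^sub>0 int"
  proof (rule poly_mapping_eqI)
    fix k
    from that have "Poly_Mapping.lookup x k = - Poly_Mapping.lookup x k"
      by (metis lookup_uminus)
    then show "Poly_Mapping.lookup x k = Poly_Mapping.lookup 0 k" by simp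
  qed
  from this[OF self] eq show ?thesis by simp
qed

lemma simplicial_boundary_boundary:
  assumes "simplicial_complex K" "linear_order_on (\<Union>K) r"
    and "c \<in> carrier (simplicial_chain_group K d)"
  shows "simplicial_boundary r (simplicial_boundary r c) = 0"
proof -
  have "Poly_Mapping.keys c \<subseteq> {\<sigma> \<in> K. finite \<sigma> \<and> int (card \<sigma>) = d + 1}"
    using assms by (simp add: simplicial_chain_group_def)
  then show ?thesis
  proof (induction c rule: frag_induction)
    case zero show ?case by (simp add: simplicial_boundary_def)
  next
    case (one \<sigma>)
    then show ?case using simplicial_boundary_boundary_of[OF assms(2)] by auto
  next
    case (diff a b)
    then show ?case by (simp add: simplicial_boundary_diff)
  qed
qed

lemma simplicial_boundary_in_chain_group:
  assumes K: "simplicial_complex K" and c: "c \<in> carrier (simplicial_chain_group K (d + 1))"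
  shows "simplicial_boundary r c \<in> carrier (simplicial_chain_group K d)"
proof -
  have "Poly_Mapping.keys c \<subseteq> {\<sigma> \<in> K. finite \<sigma> \<and> int (card \<sigma>) = (d + 1) + 1}"
    using c by (simp add: simplicial_chain_group_def)
  then show ?thesis
  proof (induction c rule: frag_induction)
    case zero show ?case by (simp add: simplicial_boundary_def simplicial_chain_group_def)
  next
    case (one \<sigma>)
    have "frag_cmul k (frag_of (\<sigma> - {v})) \<in> carrier (simplicial_chain_group K d)"
      if "v \<in> \<sigma>" for v k
    proof -
      have "\<sigma> - {v} \<in> K" using K one by (auto simp: simplicial_complex_def)
      moreover have "card \<sigma> = Suc (card (\<sigma> - {v}))"
        using one that by (metis (mono_tags, lifting) card.remove mem_Collect_eq)
      ultimately show ?thesis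
        using one by (auto simp: simplicial_chain_group_def split: if_splits)
    qed
    then show ?case
      unfolding simplicial_boundary_of simplicial_chain_group_def
      by (intro sum_closed_free_Abelian_group) auto
  next
    case (diff a b)
    then show ?case
      by (auto simp: simplicial_boundary_diff simplicial_chain_group_def dest!: subsetD[OF keys_diff])
  qed
qed

lemma subgroup_free_Abelian_groupI:
  assumes "A \<subseteq> carrier (free_Abelian_group S)" "0 \<in> A" "\<And>a b. a \<in> A \<Longrightarrow> b \<in> A \<Longrightarrow> a - b \<in> A"
  shows "subgroup A (free_Abelian_group S)"
proof -
  have neg: "- a \<in> A" if "a \<in> A" for a using assms(3)[OF assms(2) that] by simp
  have add: "a + b \<in> A" if "a \<in> A" "b \<in> A" for a b using assms(3)[OF that(1) neg[OF that(2)]] by simp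
  show ?thesis
  proof (rule subgroup.intro)
    fix x assume "x \<in> A"
    moreover have "Poly_Mapping.keys x \<subseteq> S"
      using subsetD[OF assms(1) \<open>x \<in> A\<close>] by simp
    ultimately show "inv\<^bsub>free_Abelian_group S\<^esub> x \<in> A"
      using neg by simp
  qed (use assms(1,2) add in simp_all)
qed

lemma subgroup_simplicial_cycles:
  "subgroup (simplicial_cycles r K d) (simplicial_chain_group K d)"
  unfolding simplicial_chain_group_def
proof (rule subgroup_free_Abelian_groupI)
  fix a b assume "a \<in> simplicial_cycles r K d" "b \<in> simplicial_cycles r K d"
  then show "a - b \<in> simplicial_cycles r K d"
    by (auto simp: simplicial_cycles_def simplicial_chain_group_def simplicial_boundary_diff
        dest!: subsetD[OF keys_diff])
qed (auto simp: simplicial_cycles_def simplicial_chain_group_def simplicial_boundary_def)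

lemma subgroup_simplicial_boundaries:
  assumes "simplicial_complex K"
  shows "subgroup (simplicial_boundaries r K d) (simplicial_chain_group K d)"
  unfolding simplicial_chain_group_def
proof (rule subgroup_free_Abelian_groupI)
  show "simplicial_boundaries r K d
      \<subseteq> carrier (free_Abelian_group {\<sigma> \<in> K. finite \<sigma> \<and> int (card \<sigma>) = d + 1})"
    using simplicial_boundary_in_chain_group[OF assms]
    unfolding simplicial_boundaries_def simplicial_chain_group_def by blast
  have "simplicial_boundary r 0 = 0"
    by (simp add: simplicial_boundary_def)
  moreover have "0 \<in> carrier (simplicial_chain_group K (d + 1))"
    by (simp add: simplicial_chain_group_def)
  ultimately show "0 \<in> simplicial_boundaries r K d"
    unfolding simplicial_boundaries_def by force
  fix a b assume "a \<in> simplicial_boundaries r K d" "b \<in> simplicial_boundaries r K d"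
  then obtain a' b' where ab: "a = simplicial_boundary r a'" "b = simplicial_boundary r b'"
    "a' \<in> carrier (simplicial_chain_group K (d + 1))" "b' \<in> carrier (simplicial_chain_group K (d + 1))"
    by (auto simp: simplicial_boundaries_def)
  have "a' - b' \<in> carrier (simplicial_chain_group K (d + 1))"
    using ab(3,4) by (auto simp: simplicial_chain_group_def dest!: subsetD[OF keys_diff])
  then show "a - b \<in> simplicial_boundaries r K d"
    unfolding simplicial_boundaries_def ab(1,2) simplicial_boundary_diff[symmetric] by (rule imageI)
qed

lemma simplicial_boundaries_subset_cycles:
  assumes "simplicial_complex K" "linear_order_on (\<Union>K) r"
  shows "simplicial_boundaries r K d \<subseteq> simplicial_cycles r K d"
  using simplicial_boundary_boundary[OF assms] simplicial_boundary_in_chain_group[OF assms(1)]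
  by (auto simp: simplicial_boundaries_def simplicial_cycles_def)

lemma comm_group_reduced_homology_group:
  assumes "simplicial_complex K" "linear_order_on (\<Union>K) r"
  shows "comm_group (reduced_homology_group r K d)"
proof -
  let ?C = "simplicial_chain_group K d" and ?Z = "simplicial_cycles r K d"
    and ?B = "simplicial_boundaries r K d"
  interpret C: comm_group ?C
    by (simp add: simplicial_chain_group_def abelian_free_Abelian_group)
  interpret Z: comm_group "subgroup_generated ?C ?Z"
    by (rule C.abelian_subgroup_generated) (simp add: C.comm_group_axioms)
  have "subgroup ?B (subgroup_generated ?C ?Z)"
    using subgroup_simplicial_boundaries[OF assms(1)] simplicial_boundaries_subset_cycles[OF assms]
    by (intro C.subgroup_of_subgroup_generated)
  then show ?thesis
    unfolding reduced_homology_group_def by (rule Z.abelian_FactGroup)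
qed


section \<open>Matching complexes and chessboard complexes\<close>

text \<open>Edges are two-element sets of vertices; the faces are the finite sets of pairwise disjoint
  edges. In the bipartite case the two parts \<open>[m]\<close> and \<open>[n]'\<close> are separated by \<^const>\<open>Inl\<close> and
  \<^const>\<open>Inr\<close>.\<close>

definition matchings :: "'v set set \<Rightarrow> 'v set set set" where
  "matchings E = {M. M \<subseteq> E \<and> finite M \<and> pairwise disjnt M}"

definition complete_graph_edges :: "nat \<Rightarrow> nat set set" where
  "complete_graph_edges n = {{i, j} | i j. i \<in> {1..n} \<and> j \<in> {1..n} \<and> i \<noteq> j}"

definition complete_bipartite_edges :: "nat \<Rightarrow> nat \<Rightarrow> (nat + nat) set set" where
  "complete_bipartite_edges m n = {{Inl i, Inr j} | i j. i \<in> {1..m} \<and> j \<in> {1..n}}"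

definition matching_complex :: "nat \<Rightarrow> nat set set set" where
  "matching_complex n = matchings (complete_graph_edges n)"

definition chessboard_complex :: "nat \<Rightarrow> nat \<Rightarrow> (nat + nat) set set set" where
  "chessboard_complex m n = matchings (complete_bipartite_edges m n)"

lemma simplicial_complex_matchings: "simplicial_complex (matchings E)"
  by (auto simp: simplicial_complex_def matchings_def intro: finite_subset pairwise_subset)

lemma Union_matchings: "\<Union>(matchings E) = E"
proof
  show "E \<subseteq> \<Union>(matchings E)"
  proof
    fix e assume "e \<in> E"
    then have "{e} \<in> matchings E" by (simp add: matchings_def)
    then show "e \<in> \<Union>(matchings E)" by blast
  qed
qed (auto simp: matchings_def)

definition nu_matching :: "nat \<Rightarrow> int" where
  "nu_matching n = \<lfloor>(real n + 1) / 3\<rfloor> - 1"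

definition nu_chessboard :: "nat \<Rightarrow> nat \<Rightarrow> int" where
  "nu_chessboard m n = min (int m) (min (int n) \<lfloor>(real m + real n + 1) / 3\<rfloor>) - 1"

end

theory Submission
  imports Defs "HOL-Library.Function_Algebras" "HOL-Library.Numeral_Type"
begin

text \<open>
The classes that survive are products of small cycles. For a path \<open>a\<close>-\<open>b\<close>-\<open>c\<close> the difference of the
edges \<open>ab\<close> and \<open>bc\<close> is a reduced 0-cycle on three vertices, and the product of \<open>k\<close> disjoint such cycles is a cycle with
\<open>k\<close> edges per face. If it does not bound on \<open>3 k + 1\<close> vertices, then it does not bound in any
subcomplex either. This covers the matching complex on \<open>3 k\<close> and \<open>3 k + 1\<close> vertices, and also the
chessboard complexes, which are subcomplexes of the matching complex on \<open>m + n\<close> vertices. If the number of vertices is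
\<open>3 k + 2\<close>, one path is replaced by a 1-cycle of length six on five vertices; contracting one of its edges
leads back to a product of \<open>k\<close> paths (\<open>hexagon_not_bound\<close>). Only for boards with one side at least twice as
long as the other is a different argument needed: there the product of paths has top dimension.

The main point is that a product of \<open>k\<close> paths is not a boundary on \<open>3 k + 1\<close> vertices, even modulo 3
(\<open>paths_essential\<close>). Suppose that the product of a path \<open>a\<close>-\<open>b\<close>-\<open>c\<close> with a cycle \<open>z\<close> is the boundary of \<open>x\<close>.
Sorting the faces of \<open>x\<close> by their edges at \<open>a\<close>, \<open>b\<close>, \<open>c\<close> and adding up the parts with suitable weights modulo 3
shows that \<open>z\<close> bounds up to products of a triangle, that is, the sum \<open>pq + qs + ps\<close> of its edges,
with cycles that have one edge less than \<open>z\<close> (\<open>path_bound_step\<close>). Such a product is a cycle because the triangle has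
augmentation 3. It is itself a boundary as soon as the second factor has an edge
(\<open>tri_mcycles_bound\<close>). Indeed, the connectivity of matching complexes (\<open>mcycles_bound\<close>) implies that
bottom cycles on \<open>3 k + 1\<close> vertices are generated by products with paths (\<open>bottom_cycles_decompose\<close>). This reduces
the claim to the product of a triangle and a path on seven vertices, and there moving the vertices
around shows that the class equals its own negative (\<open>path_tri_bound\<close>). Hence the product with a path does not bound
if \<open>z\<close> does not, and the induction starts on four vertices with a functional that
vanishes on boundaries and on triangles (\<open>single_path_essential\<close>).
\<close>

section \<open>The exterior algebra of an ordered simplex\<close>

lemma sum_fun_apply: "(\<Sum>i\<in>I. f i) x = (\<Sum>i\<in>I. f i x)"
  by (induction I rule: infinite_finite_induct) auto

text \<open>The chains of the full simplex on a finite ordered vertex set \<open>E\<close> form the exterior algebra on \<open>E\<close>.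
An element is stored as its coefficient function on subsets of \<open>E\<close>. Left multiplication by a
generator (\<open>wedge\<close>) and the dual contraction (\<open>contr\<close>) satisfy the Clifford relations, and the
augmented simplicial boundary is the sum of all contractions. These relations take care of nearly all
signs in the later arguments.\<close>

locale oriented_simplex =
  fixes E :: "'e set" and r :: "'e rel"
  assumes finite_E: "finite E" and linear_E: "linear_order_on E r"
begin

definition osgn :: "'e \<Rightarrow> 'e set \<Rightarrow> 'k::comm_ring_1" where
  "osgn e \<sigma> = (-1) ^ card {u \<in> \<sigma> \<inter> E. (u, e) \<in> r - Id}"

definition wedge :: "'e \<Rightarrow> ('e set \<Rightarrow> 'k::comm_ring_1) \<Rightarrow> 'e set \<Rightarrow> 'k" where
  "wedge e c = (\<lambda>\<sigma>. if e \<in> \<sigma> then osgn e \<sigma> * c (\<sigma> - {e}) else 0)"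

definition contr :: "'e \<Rightarrow> ('e set \<Rightarrow> 'k::comm_ring_1) \<Rightarrow> 'e set \<Rightarrow> 'k" where
  "contr e c = (\<lambda>\<sigma>. if e \<in> \<sigma> then 0 else osgn e \<sigma> * c (insert e \<sigma>))"

definition bd :: "('e set \<Rightarrow> 'k::comm_ring_1) \<Rightarrow> 'e set \<Rightarrow> 'k" where
  "bd c = (\<Sum>e\<in>E. contr e c)"

lemma osgn_sq [simp]: "osgn e \<sigma> * osgn e \<sigma> = 1"
  by (simp add: osgn_def flip: power_add)

lemma osgn_sq' [simp]: "osgn e \<sigma> * (osgn e \<sigma> * x) = x"
  by (simp flip: mult.assoc)

lemma osgn_insert_self [simp]: "osgn e (insert e \<sigma>) = osgn e \<sigma>"
  unfolding osgn_def by (rule arg_cong[where f = "\<lambda>A. (-1) ^ card A"]) auto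

lemma osgn_remove_self [simp]: "osgn e (\<sigma> - {e}) = osgn e \<sigma>"
  unfolding osgn_def by (rule arg_cong[where f = "\<lambda>A. (-1) ^ card A"]) auto

lemma osgn_insert:
  assumes "f \<in> E" "f \<notin> \<sigma>" "e \<noteq> f"
  shows "osgn e (insert f \<sigma>) = (if (f, e) \<in> r then - osgn e \<sigma> else osgn e \<sigma>)"
proof (cases "(f, e) \<in> r")
  case True
  have "{u \<in> insert f \<sigma> \<inter> E. (u, e) \<in> r - Id} = insert f {u \<in> \<sigma> \<inter> E. (u, e) \<in> r - Id}"
    using assms True by auto
  moreover have "f \<notin> {u \<in> \<sigma> \<inter> E. (u, e) \<in> r - Id}" "finite {u \<in> \<sigma> \<inter> E. (u, e) \<in> r - Id}"
    using assms finite_E by auto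
  ultimately show ?thesis using True by (simp add: osgn_def)
next
  case False
  have "{u \<in> insert f \<sigma> \<inter> E. (u, e) \<in> r - Id} = {u \<in> \<sigma> \<inter> E. (u, e) \<in> r - Id}"
    using assms False by auto
  then show ?thesis using False by (simp add: osgn_def)
qed

lemma osgn_remove:
  assumes "f \<in> E" "f \<in> \<sigma>" "e \<noteq> f"
  shows "osgn e (\<sigma> - {f}) = (if (f, e) \<in> r then - osgn e \<sigma> else (osgn e \<sigma> :: 'k::comm_ring_1))"
  using osgn_insert[of f "\<sigma> - {f}" e, where 'a = 'k] assms by (simp add: insert_absorb)

lemma order_cases:
  assumes "e \<in> E" "f \<in> E" "e \<noteq> f"
  shows "((e, f) \<in> r) = ((f, e) \<notin> r)"
  using linear_E assms unfolding linear_order_on_def partial_order_on_def total_on_def antisym_def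
  by blast

lemma wedge_wedge:
  assumes "e \<in> E" "f \<in> E"
  shows "wedge e (wedge f c) = - wedge f (wedge e c)"
proof (cases "e = f")
  case False
  have 1: "\<sigma> - {e} - {f} = \<sigma> - {f} - {e}" for \<sigma> by auto
  show ?thesis
    using order_cases[OF assms False] assms False
    by (auto simp: wedge_def fun_eq_iff osgn_remove 1 algebra_simps)
qed (auto simp: wedge_def fun_eq_iff)

lemma contr_contr:
  assumes "e \<in> E" "f \<in> E"
  shows "contr e (contr f c) = - contr f (contr e c)"
proof (cases "e = f")
  case False
  then show ?thesis
    using order_cases[OF assms False] assms
    by (auto simp: contr_def fun_eq_iff osgn_insert insert_commute algebra_simps)
qed (auto simp: contr_def fun_eq_iff)

lemma contr_wedge:
  assumes "e \<in> E" "f \<in> E" "e \<noteq> f"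
  shows "contr e (wedge f c) = - wedge f (contr e c)"
proof -
  have 1: "insert e \<sigma> - {f} = insert e (\<sigma> - {f})" for \<sigma> using assms by auto
  show ?thesis
    using order_cases[OF assms] assms
    by (auto simp: contr_def wedge_def fun_eq_iff osgn_remove osgn_insert 1 algebra_simps)
qed

lemma contr_wedge_self: "contr e (wedge e c) = c - wedge e (contr e c)"
  by (auto simp: contr_def wedge_def fun_eq_iff insert_absorb)

lemma wedge_contr_apply: "wedge e (contr e c) \<sigma> = (if e \<in> \<sigma> then c \<sigma> else 0)"
  by (auto simp: contr_def wedge_def insert_absorb)

lemma wedge_zero [simp]: "wedge e 0 = 0" and contr_zero [simp]: "contr e 0 = 0"
  by (auto simp: contr_def wedge_def fun_eq_iff)

lemma wedge_add: "wedge e (c + c') = wedge e c + wedge e c'"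
  and contr_add: "contr e (c + c') = contr e c + contr e c'"
  and wedge_minus: "wedge e (- c) = - wedge e c"
  and contr_minus: "contr e (- c) = - contr e c"
  and wedge_diff: "wedge e (c - c') = wedge e c - wedge e c'"
  and contr_diff: "contr e (c - c') = contr e c - contr e c'"
  by (auto simp: contr_def wedge_def fun_eq_iff algebra_simps)

lemma wedge_sum: "wedge e (\<Sum>i\<in>I. c i) = (\<Sum>i\<in>I. wedge e (c i))"
  by (induction I rule: infinite_finite_induct)
     (simp_all only: sum.infinite sum.empty sum.insert wedge_zero wedge_add if_True not_False_eq_True)

lemma contr_sum: "contr e (\<Sum>i\<in>I. c i) = (\<Sum>i\<in>I. contr e (c i))"
  by (induction I rule: infinite_finite_induct)
     (simp_all only: sum.infinite sum.empty sum.insert contr_zero contr_add if_True not_False_eq_True)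

lemma bd_zero [simp]: "bd 0 = 0"
  and bd_add: "bd (c + c') = bd c + bd c'"
  and bd_minus: "bd (- c) = - bd c"
  and bd_diff: "bd (c - c') = bd c - bd c'"
  by (simp_all add: bd_def contr_add contr_minus contr_diff sum.distrib sum_negf sum_subtractf)

lemma bd_sum: "bd (\<Sum>i\<in>I. c i) = (\<Sum>i\<in>I. bd (c i))"
  by (induction I rule: infinite_finite_induct)
     (simp_all only: sum.infinite sum.empty sum.insert bd_zero bd_add if_True not_False_eq_True)

text \<open>The cone formula: multiplication by a single generator is a contracting homotopy of the full
simplex. It is the source of all homologies constructed below.\<close>

lemma bd_wedge:
  assumes "f \<in> E"
  shows "bd (wedge f c) = c - wedge f (bd c)"
proof -
  have "bd (wedge f c) = contr f (wedge f c) + (\<Sum>e\<in>E-{f}. contr e (wedge f c))"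
    unfolding bd_def using assms finite_E by (simp add: sum.remove)
  also have "(\<Sum>e\<in>E-{f}. contr e (wedge f c)) = - (\<Sum>e\<in>E-{f}. wedge f (contr e c))"
    unfolding sum_negf[symmetric] using assms by (intro sum.cong) (auto simp: contr_wedge)
  also have "contr f (wedge f c) + \<dots> = c - (wedge f (contr f c) + (\<Sum>e\<in>E-{f}. wedge f (contr e c)))"
    by (simp add: contr_wedge_self)
  also have "\<dots> = c - wedge f (bd c)"
    unfolding bd_def wedge_sum using assms finite_E by (simp add: sum.remove)
  finally show ?thesis .
qed

lemma contr_bd:
  assumes "e \<in> E"
  shows "contr e (bd c) = - bd (contr e c)"
  unfolding bd_def contr_sum sum_negf[symmetric]
  by (intro sum.cong) (use assms contr_contr in auto)

end

text \<open>In large matching complexes the bottom homology is annihilated by 3, so rational coefficients do not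
see it. The field with three elements does.\<close>

type_synonym F3 = 3

lemma F3_three: "x + x + x = (0::F3)"
proof -
  have "x + x + x = 3 * x" by (simp add: algebra_simps)
  also have "(3::F3) = 0" by simp
  finally show ?thesis by simp
qed

lemma three_zero: "c + c + c = (0 :: 'a \<Rightarrow> F3)"
  by (rule ext) (simp only: plus_fun_apply zero_fun_apply F3_three)

lemma eq_neg_self: "c = 0" if "c = - c" for c :: "'a \<Rightarrow> F3"
proof -
  have "c + c = 0" using that by (metis add.right_inverse)
  then show ?thesis using three_zero[of c] by simp
qed

context oriented_simplex
begin

lemma bd_bd: "bd (bd c) = (0 :: 'e set \<Rightarrow> F3)"
proof (rule eq_neg_self)
  \<comment> \<open>Over \<open>F3\<close> an element equal to its own negative vanishes.\<close>
  have "bd (bd c) = (\<Sum>e\<in>E. - bd (contr e c))"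
    unfolding bd_def[of "bd c"] by (rule sum.cong) (auto simp: contr_bd)
  also have "\<dots> = - bd (bd c)"
    by (simp add: bd_def[of c] bd_sum sum_negf)
  finally show "bd (bd c) = - bd (bd c)" .
qed

end

section \<open>Chains of matchings and the connectivity bound\<close>

definition pairs :: "'v set \<Rightarrow> 'v set set" where
  "pairs S = {{a, b} | a b. a \<in> S \<and> b \<in> S \<and> a \<noteq> b}"

definition matchings_of_size :: "nat \<Rightarrow> 'v set \<Rightarrow> 'v set set set" where
  "matchings_of_size j S = {\<sigma>. \<sigma> \<subseteq> pairs S \<and> card \<sigma> = j \<and> pairwise disjnt \<sigma>}"

text \<open>The vertices left uncovered by a matching are not recorded. Hence a chain on \<open>S\<close> is a chain on every
larger vertex set, and multiplication by an edge disjoint from \<open>S\<close> turns matchings into matchings.\<close>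

definition mchains :: "nat \<Rightarrow> 'v set \<Rightarrow> ('v set set \<Rightarrow> 'k::zero) set" where
  "mchains j S = {c. \<forall>\<sigma>. c \<sigma> \<noteq> 0 \<longrightarrow> \<sigma> \<in> matchings_of_size j S}"

lemma pairsI: "a \<in> S \<Longrightarrow> b \<in> S \<Longrightarrow> a \<noteq> b \<Longrightarrow> {a, b} \<in> pairs S"
  by (auto simp: pairs_def)

lemma pairs_mono: "S \<subseteq> T \<Longrightarrow> pairs S \<subseteq> pairs T"
  by (auto simp: pairs_def)

lemma pairs_subset: "e \<in> pairs S \<Longrightarrow> e \<subseteq> S"
  by (auto simp: pairs_def)

lemma pairs_eq: "pairs S = {e. e \<subseteq> S \<and> card e = 2}"
  by (auto simp: pairs_def card_2_iff)

lemma finite_pairs: "finite S \<Longrightarrow> finite (pairs S)"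
  by (rule finite_subset[of _ "Pow S"]) (auto simp: pairs_def)

lemma mchains_mono:
  assumes "c \<in> mchains j S" "S \<subseteq> T" shows "c \<in> mchains j T"
  using assms pairs_mono[OF assms(2)] unfolding mchains_def matchings_of_size_def by blast

lemma mchains_zero [simp]: "0 \<in> mchains j S"
  by (auto simp: mchains_def)

lemma mchains_add: "c \<in> mchains j S \<Longrightarrow> c' \<in> mchains j S \<Longrightarrow> c + c' \<in> mchains j S"
  for c :: "_ \<Rightarrow> 'k::comm_ring_1"
  unfolding mchains_def plus_fun_def by (clarify) (metis add.left_neutral)

lemma mchains_uminus: "c \<in> mchains j S \<Longrightarrow> - c \<in> mchains j S"
  for c :: "_ \<Rightarrow> 'k::comm_ring_1"
  by (auto simp: mchains_def)

lemma mchains_diff: "c \<in> mchains j S \<Longrightarrow> c' \<in> mchains j S \<Longrightarrow> c - c' \<in> mchains j S"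
  for c :: "_ \<Rightarrow> 'k::comm_ring_1"
  using mchains_add[of c j S "- c'"] mchains_uminus[of c' j S] by simp

lemma mchains_sum: "(\<And>i. i \<in> I \<Longrightarrow> c i \<in> mchains j S) \<Longrightarrow> (\<Sum>i\<in>I. c i) \<in> mchains j S"
  for c :: "_ \<Rightarrow> _ \<Rightarrow> 'k::comm_ring_1"
  by (induction I rule: infinite_finite_induct)
     (simp_all only: sum.infinite sum.empty sum.insert mchains_zero mchains_add insert_iff if_True
       not_False_eq_True simp_thms)

locale ordered_matchings =
  fixes V :: "'v set" and r :: "'v set rel"
  assumes finite_V: "finite V" and linear_pairs: "linear_order_on (pairs V) r"

sublocale ordered_matchings \<subseteq> oriented_simplex "pairs V" r
  using finite_V linear_pairs by unfold_locales (auto simp: finite_pairs)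

context ordered_matchings
begin

abbreviation W :: "'v \<Rightarrow> 'v \<Rightarrow> ('v set set \<Rightarrow> 'k::comm_ring_1) \<Rightarrow> 'v set set \<Rightarrow> 'k" where
  "W a b \<equiv> wedge {a, b}"

abbreviation R :: "'v \<Rightarrow> 'v \<Rightarrow> ('v set set \<Rightarrow> 'k::comm_ring_1) \<Rightarrow> 'v set set \<Rightarrow> 'k" where
  "R a b \<equiv> contr {a, b}"

lemma contr_mchains:
  assumes c: "c \<in> mchains (Suc j) S" and S: "S \<subseteq> V"
  shows "contr e c \<in> mchains j (S - e)"
  unfolding mchains_def
proof safe
  fix \<sigma> assume "contr e c \<sigma> \<noteq> 0"
  then have e: "e \<notin> \<sigma>" and "c (insert e \<sigma>) \<noteq> 0"
    by (auto simp: contr_def split: if_splits)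
  then have m: "insert e \<sigma> \<in> matchings_of_size (Suc j) S"
    using c by (auto simp: mchains_def)
  have "finite \<sigma>"
    using m finite_subset[OF S finite_V] finite_pairs[of S] finite_subset
    by (auto simp: matchings_of_size_def)
  moreover have "\<sigma> \<subseteq> pairs (S - e)"
  proof
    fix f assume f: "f \<in> \<sigma>"
    then have "disjnt f e" "f \<in> pairs S"
      using m e by (auto simp: matchings_of_size_def pairwise_insert)
    then show "f \<in> pairs (S - e)" by (auto simp: pairs_eq disjnt_def)
  qed
  ultimately show "\<sigma> \<in> matchings_of_size j (S - e)"
    using m e by (auto simp: matchings_of_size_def pairwise_insert)
qed

lemma contr_mchains_0:
  assumes c: "c \<in> mchains 0 S" and S: "S \<subseteq> V"
  shows "contr e c = 0"
proof
  fix \<sigma>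
  have "finite (pairs S)" using finite_subset[OF S finite_V] by (rule finite_pairs)
  then have "insert e \<sigma> \<notin> matchings_of_size 0 S"
    by (auto simp: matchings_of_size_def card_eq_0_iff dest: finite_subset[rotated])
  then have "c (insert e \<sigma>) = 0" using c by (auto simp: mchains_def)
  then show "contr e c \<sigma> = 0 \<sigma>" by (simp add: contr_def)
qed

lemma matchings_of_size_0:
  assumes "S \<subseteq> V" shows "matchings_of_size 0 S = {{}}"
proof -
  have "finite (pairs S)" using finite_subset[OF assms finite_V] by (rule finite_pairs)
  then show ?thesis
    by (auto simp: matchings_of_size_def card_eq_0_iff dest: finite_subset[rotated])
qed

lemma mchains_0_mono:
  assumes "c \<in> mchains 0 S" "S \<subseteq> V" shows "c \<in> mchains 0 T"
  using assms(1) unfolding mchains_def matchings_of_size_0[OF assms(2)]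
  by (auto simp: matchings_of_size_def)

lemma contr_mchains_outside:
  assumes c: "c \<in> mchains j S" and e: "e \<notin> pairs S"
  shows "contr e c = 0"
proof
  fix \<sigma>
  have "c (insert e \<sigma>) = 0" using assms by (auto simp: mchains_def matchings_of_size_def)
  then show "contr e c \<sigma> = 0 \<sigma>" by (simp add: contr_def)
qed

lemma wedge_mchains:
  assumes c: "c \<in> mchains j S" and e: "e \<in> pairs T" and S: "S \<subseteq> T - e" and T: "T \<subseteq> V"
  shows "wedge e c \<in> mchains (Suc j) T"
  unfolding mchains_def
proof safe
  fix \<sigma> assume "wedge e c \<sigma> \<noteq> 0"
  then have es: "e \<in> \<sigma>" and "c (\<sigma> - {e}) \<noteq> 0"
    by (auto simp: wedge_def split: if_splits)
  then have m: "\<sigma> - {e} \<in> matchings_of_size j S"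
    using c by (auto simp: mchains_def)
  have fin: "finite (\<sigma> - {e})"
  proof (rule finite_subset)
    show "\<sigma> - {e} \<subseteq> pairs S" using m by (simp add: matchings_of_size_def)
    show "finite (pairs S)" using S T by (intro finite_pairs finite_subset[OF _ finite_V]) auto
  qed
  have dis: "disjnt f e" if "f \<in> \<sigma> - {e}" for f
  proof -
    have "f \<in> pairs S" using m that by (auto simp: matchings_of_size_def)
    then show ?thesis using pairs_subset S by (fastforce simp: disjnt_def)
  qed
  define \<tau> where "\<tau> = \<sigma> - {e}"
  have "insert e \<tau> \<in> matchings_of_size (Suc j) T"
  proof -
    have "\<tau> \<subseteq> pairs S" "card \<tau> = j" "pairwise disjnt \<tau>" "finite \<tau>" "e \<notin> \<tau>"
      using m fin by (auto simp: \<tau>_def matchings_of_size_def)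
    moreover have "disjnt f e \<and> disjnt e f" if "f \<in> \<tau>" for f
      using dis[of f] that unfolding \<tau>_def[symmetric] by (simp add: disjnt_sym)
    moreover have "pairs S \<subseteq> pairs T" using S by (intro pairs_mono) auto
    ultimately show ?thesis
      using e by (auto simp: matchings_of_size_def pairwise_insert)
  qed
  moreover have "insert e \<tau> = \<sigma>" using es by (auto simp: \<tau>_def)
  ultimately show "\<sigma> \<in> matchings_of_size (Suc j) T" by simp
qed

lemma W_mchains:
  assumes "c \<in> mchains j S" "a \<in> T" "b \<in> T" "a \<noteq> b" "a \<notin> S" "b \<notin> S" "S \<subseteq> T" "T \<subseteq> V"
  shows "W a b c \<in> mchains (Suc j) T"
  using assms by (intro wedge_mchains[of c j S] pairsI) auto

lemma bd_mchains_0: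
  assumes "c \<in> mchains 0 S" "S \<subseteq> V"
  shows "bd c = 0"
  unfolding bd_def using contr_mchains_0[OF assms] by (intro sum.neutral) auto

text \<open>A matching has at most one edge at the vertex \<open>a\<close>. Subtracting the parts \<open>W a p (R a p c)\<close>
therefore leaves exactly the part of \<open>c\<close> that does not cover \<open>a\<close>.\<close>

lemma remove_vertex_mchains:
  assumes c: "c \<in> mchains j S" and S: "S \<subseteq> V" and a: "a \<in> S"
  shows "c - (\<Sum>p\<in>S-{a}. W a p (R a p c)) \<in> mchains j (S - {a})"
  unfolding mchains_def
proof safe
  fix \<sigma> assume nz: "(c - (\<Sum>p\<in>S-{a}. W a p (R a p c))) \<sigma> \<noteq> 0"
  have fin: "finite S" using finite_subset[OF S finite_V] .
  have eq: "(\<Sum>p\<in>S-{a}. W a p (R a p c)) \<sigma> = (\<Sum>p\<in>S-{a}. if {a, p} \<in> \<sigma> then c \<sigma> else 0)"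
    by (simp add: sum_fun_apply wedge_contr_apply)
  have m: "\<sigma> \<in> matchings_of_size j S"
  proof (rule ccontr)
    assume "\<sigma> \<notin> matchings_of_size j S"
    then have "c \<sigma> = 0" using c by (auto simp: mchains_def)
    then have "(\<Sum>p\<in>S-{a}. if {a, p} \<in> \<sigma> then c \<sigma> else 0) = 0" by (intro sum.neutral) auto
    with nz eq \<open>c \<sigma> = 0\<close> show False by (simp only: minus_apply diff_self simp_thms)
  qed
  show "\<sigma> \<in> matchings_of_size j (S - {a})"
  proof (cases "\<exists>p\<in>S-{a}. {a, p} \<in> \<sigma>")
    case True
    then obtain p where p: "p \<in> S - {a}" "{a, p} \<in> \<sigma>" by auto
    have "q = p" if q: "{a, q} \<in> \<sigma>" for q
    proof -
      have "\<not> disjnt {a, q} {a, p}" by (simp add: disjnt_def)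
      moreover have "pairwise disjnt \<sigma>" using m by (simp add: matchings_of_size_def)
      ultimately have "{a, q} = {a, p}"
        using pairwiseD[of disjnt \<sigma> "{a, q}" "{a, p}"] p(2) q by blast
      then show ?thesis by (auto simp: doubleton_eq_iff)
    qed
    then have "{a, q} \<in> \<sigma> \<longleftrightarrow> q = p" for q using p by blast
    then have "(\<Sum>q\<in>S-{a}. if {a, q} \<in> \<sigma> then c \<sigma> else 0) = (\<Sum>q\<in>S-{a}. if q = p then c \<sigma> else 0)"
      by simp
    also have "\<dots> = c \<sigma>" using p fin by simp
    finally show ?thesis using nz eq by (simp only: minus_apply diff_self simp_thms)
  next
    case False
    have "f \<in> pairs (S - {a})" if "f \<in> \<sigma>" for f
    proof -
      have "f \<in> pairs S" using m that by (auto simp: matchings_of_size_def)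
      then obtain x y where xy: "f = {x, y}" "x \<in> S" "y \<in> S" "x \<noteq> y" by (auto simp: pairs_def)
      have "x \<noteq> a" using False that xy by blast
      moreover have "y \<noteq> a"
      proof
        assume "y = a"
        then have "f = {a, x}" "x \<in> S - {a}" using xy by auto
        then show False using False that by blast
      qed
      ultimately show ?thesis unfolding xy(1) using xy(2-4) by (intro pairsI) auto
    qed
    then show ?thesis using m by (auto simp: matchings_of_size_def)
  qed
qed

definition mcycles :: "nat \<Rightarrow> 'v set \<Rightarrow> ('v set set \<Rightarrow> F3) set" where
  "mcycles j S = {c \<in> mchains j S. bd c = 0}"

definition mbounds :: "nat \<Rightarrow> 'v set \<Rightarrow> ('v set set \<Rightarrow> F3) set" where
  "mbounds j S = bd ` mchains (Suc j) S"

lemma pairs_V: "S \<subseteq> V \<Longrightarrow> a \<in> S \<Longrightarrow> b \<in> S \<Longrightarrow> a \<noteq> b \<Longrightarrow> {a, b} \<in> pairs V"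
  by (auto intro: pairsI)

lemma mboundsI: "b \<in> mchains (Suc j) S \<Longrightarrow> c = bd b \<Longrightarrow> c \<in> mbounds j S"
  by (auto simp: mbounds_def)

lemma mbounds_zero [simp]: "0 \<in> mbounds j S"
  by (rule mboundsI[of 0]) auto

lemma mbounds_add: "c \<in> mbounds j S \<Longrightarrow> c' \<in> mbounds j S \<Longrightarrow> c + c' \<in> mbounds j S"
  unfolding mbounds_def by (auto simp flip: bd_add intro: mchains_add)

lemma mbounds_uminus: "c \<in> mbounds j S \<Longrightarrow> - c \<in> mbounds j S"
  unfolding mbounds_def by (auto simp flip: bd_minus intro: mchains_uminus)

lemma mbounds_sum: "(\<And>i. i \<in> I \<Longrightarrow> c i \<in> mbounds j S) \<Longrightarrow> (\<Sum>i\<in>I. c i) \<in> mbounds j S"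
  by (induction I rule: infinite_finite_induct)
     (simp_all only: sum.infinite sum.empty sum.insert mbounds_zero mbounds_add insert_iff if_True
       not_False_eq_True simp_thms)

lemma mcycles_mono: "c \<in> mcycles j S \<Longrightarrow> S \<subseteq> T \<Longrightarrow> c \<in> mcycles j T"
  unfolding mcycles_def using mchains_mono by blast

lemma mcycles_add: "c \<in> mcycles j S \<Longrightarrow> c' \<in> mcycles j S \<Longrightarrow> c + c' \<in> mcycles j S"
  unfolding mcycles_def by (auto simp: bd_add intro: mchains_add)

lemma mcycles_zero [simp]: "0 \<in> mcycles j S"
  by (auto simp: mcycles_def)

lemma mcycles_sum: "(\<And>i. i \<in> I \<Longrightarrow> c i \<in> mcycles j S) \<Longrightarrow> (\<Sum>i\<in>I. c i) \<in> mcycles j S"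
  by (induction I rule: infinite_finite_induct)
     (simp_all only: sum.infinite sum.empty sum.insert mcycles_zero mcycles_add insert_iff if_True
       not_False_eq_True simp_thms)

lemma contr_mcycles:
  assumes "c \<in> mcycles (Suc j) S" "S \<subseteq> V"
  shows "contr e c \<in> mcycles j (S - e)"
proof (cases "e \<in> pairs S")
  case True
  then have "e \<in> pairs V" using pairs_mono assms by blast
  then have "bd (contr e c) = - contr e (bd c)" by (simp add: contr_bd)
  then show ?thesis using assms contr_mchains[of c j S e] by (simp add: mcycles_def)
next
  case False
  then have "contr e c = 0"
    using assms contr_mchains_outside[of c "Suc j" S e] by (simp add: mcycles_def)
  then show ?thesis by (simp only: mcycles_zero)
qed

text \<open>If the coefficients \<open>R a p c\<close> of the edges at \<open>a\<close>, which are again cycles, bound, say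
\<open>R a p c = bd (b p)\<close>, then the boundary of \<open>\<Sum>p. W a p (b p)\<close> cancels every term of \<open>c\<close> that
covers \<open>a\<close>.\<close>

lemma push_off_vertex_step:
  assumes S: "S \<subseteq> V" and a: "a \<in> S" and c: "c \<in> mcycles (Suc j) S"
    and conn: "\<And>p d. p \<in> S - {a} \<Longrightarrow> d \<in> mcycles j (S - {a, p}) \<Longrightarrow> d \<in> mbounds j (S - {a, p})"
  obtains b where "b \<in> mchains (Suc (Suc j)) S" "c - bd b \<in> mcycles (Suc j) (S - {a})"
proof -
  have "\<forall>p\<in>S-{a}. \<exists>b. b \<in> mchains (Suc j) (S - {a, p}) \<and> bd b = R a p c"
  proof
    fix p assume p: "p \<in> S - {a}"
    have "R a p c \<in> mbounds j (S - {a, p})"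
      using conn[OF p] contr_mcycles[OF c S] by blast
    then show "\<exists>b. b \<in> mchains (Suc j) (S - {a, p}) \<and> bd b = R a p c"
      by (auto simp: mbounds_def)
  qed
  then obtain b where b: "\<And>p. p \<in> S - {a} \<Longrightarrow> b p \<in> mchains (Suc j) (S - {a, p})"
    "\<And>p. p \<in> S - {a} \<Longrightarrow> bd (b p) = R a p c" by metis
  define x where "x = (\<Sum>p\<in>S-{a}. W a p (b p))"
  have x: "x \<in> mchains (Suc (Suc j)) S"
    unfolding x_def using b(1) S a by (intro mchains_sum W_mchains) auto
  have "bd x = (\<Sum>p\<in>S-{a}. b p - W a p (R a p c))"
    unfolding x_def bd_sum
  proof (rule sum.cong)
    fix p assume p: "p \<in> S - {a}"
    then have "{a, p} \<in> pairs V" using S a by (intro pairs_V) auto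
    then show "bd (W a p (b p)) = b p - W a p (R a p c)"
      using b(2)[OF p] by (simp add: bd_wedge)
  qed simp
  then have "c - bd (- x) = (c - (\<Sum>p\<in>S-{a}. W a p (R a p c))) + (\<Sum>p\<in>S-{a}. b p)"
    by (simp add: bd_minus sum_subtractf)
  also have "\<dots> \<in> mchains (Suc j) (S - {a})"
  proof (intro mchains_add mchains_sum)
    show "c - (\<Sum>p\<in>S-{a}. W a p (R a p c)) \<in> mchains (Suc j) (S - {a})"
      using c S a by (intro remove_vertex_mchains) (auto simp: mcycles_def)
  next
    fix p assume "p \<in> S - {a}"
    then show "b p \<in> mchains (Suc j) (S - {a})" by (intro mchains_mono[OF b(1)]) auto
  qed
  finally have "c - bd (- x) \<in> mchains (Suc j) (S - {a})" .
  moreover have "bd (c - bd (- x)) = 0"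
    using c by (simp add: bd_diff bd_bd mcycles_def)
  ultimately show ?thesis
    using that[of "- x"] x by (simp add: mcycles_def mchains_uminus)
qed

lemma card_Diff_pair:
  assumes "finite S" "a \<in> S" "p \<in> S - {a}"
  shows "card (S - {a, p}) = card S - 2"
  using assms by (subst card_Diff_subset) auto

text \<open>The connectivity bound for matching complexes. Given two vertices \<open>a\<close> and \<open>b\<close>, a cycle is pushed
off \<open>a\<close> and then off \<open>b\<close>; the resulting cycle \<open>d\<close> avoids both, so it is the boundary of
\<open>W a b d\<close>.\<close>

theorem mcycles_bound: "S \<subseteq> V \<Longrightarrow> 3 * j + 2 \<le> card S \<Longrightarrow> c \<in> mcycles j S \<Longrightarrow> c \<in> mbounds j S"
proof (induction j arbitrary: S c)
  case 0
  then have "\<not> card S \<le> Suc 0" by simp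
  then obtain a b where ab: "a \<in> S" "b \<in> S" "a \<noteq> b"
    using finite_subset[OF 0(1) finite_V] by (auto simp: card_le_Suc0_iff_eq)
  have c: "c \<in> mchains 0 {}" using 0 mchains_0_mono by (auto simp: mcycles_def)
  show ?case
  proof (rule mboundsI)
    show "W a b c \<in> mchains (Suc 0) S" by (rule W_mchains[OF c]) (use ab 0(1) in auto)
    show "c = bd (W a b c)" using 0 ab pairs_V[of S a b] by (simp add: bd_wedge mcycles_def)
  qed
next
  case (Suc j)
  have fin: "finite S" using finite_subset[OF Suc.prems(1) finite_V] .
  have "\<not> card S \<le> Suc 0" using Suc by simp
  then obtain a b where ab: "a \<in> S" "b \<in> S" "a \<noteq> b"
    using fin by (auto simp: card_le_Suc0_iff_eq)
  obtain x where x: "x \<in> mchains (Suc (Suc j)) S" "c - bd x \<in> mcycles (Suc j) (S - {a})"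
  proof (rule push_off_vertex_step[OF Suc.prems(1) ab(1) Suc.prems(3)])
    fix p d assume "p \<in> S - {a}" "d \<in> mcycles j (S - {a, p})"
    then show "d \<in> mbounds j (S - {a, p})"
      using Suc.prems card_Diff_pair[OF fin ab(1), of p] by (intro Suc.IH) auto
  qed
  define S' where "S' = S - {a}"
  have S': "S' \<subseteq> V" "b \<in> S'" "finite S'" "card S' = card S - 1"
    using Suc.prems ab fin by (auto simp: S'_def)
  obtain y where y: "y \<in> mchains (Suc (Suc j)) S'" "(c - bd x) - bd y \<in> mcycles (Suc j) (S' - {b})"
  proof (rule push_off_vertex_step[OF S'(1,2) x(2)[folded S'_def]])
    fix p d assume "p \<in> S' - {b}" "d \<in> mcycles j (S' - {b, p})"
    then show "d \<in> mbounds j (S' - {b, p})"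
      using Suc.prems card_Diff_pair[OF S'(3,2), of p] S' by (intro Suc.IH) auto
  qed
  define d where "d = (c - bd x) - bd y"
  have d: "d \<in> mcycles (Suc j) (S - {a, b})"
    using y(2) by (simp add: d_def S'_def Diff_insert[symmetric] insert_commute)
  have "d = bd (W a b d)"
    using d ab Suc.prems pairs_V[of S a b] by (simp add: bd_wedge mcycles_def)
  moreover have "W a b d \<in> mchains (Suc (Suc j)) S"
    using d ab Suc.prems by (intro W_mchains[of _ _ "S - {a, b}"]) (auto simp: mcycles_def)
  moreover have "c = bd (x + y + W a b d)"
    using calculation(1) by (simp add: bd_add d_def algebra_simps)
  moreover have "y \<in> mchains (Suc (Suc j)) S"
    using y(1) by (rule mchains_mono) (auto simp: S'_def)
  ultimately show ?case
    using x(1) by (intro mboundsI[of "x + y + W a b d"] mchains_add) auto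
qed

lemma push_off_vertex:
  assumes S: "S \<subseteq> V" and card: "3 * j + 1 \<le> card S" and a: "a \<in> S" and c: "c \<in> mcycles j S"
  obtains b where "b \<in> mchains (Suc j) S" "c - bd b \<in> mcycles j (S - {a})"
proof (cases j)
  case 0
  then have "c \<in> mcycles j (S - {a})" using c mchains_0_mono S by (auto simp: mcycles_def)
  then show ?thesis using that[of 0] by simp
next
  case (Suc i)
  have fin: "finite S" using finite_subset[OF S finite_V] .
  show ?thesis
  proof (rule push_off_vertex_step[OF S a c[unfolded Suc]])
    fix p d assume "p \<in> S - {a}" "d \<in> mcycles i (S - {a, p})"
    then show "d \<in> mbounds i (S - {a, p})"
      using card Suc S card_Diff_pair[OF fin a, of p] by (intro mcycles_bound) auto
  qed (use that Suc in auto)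
qed

end

section \<open>Bottom cycles are generated by paths\<close>

context ordered_matchings
begin

definition homologous :: "nat \<Rightarrow> 'v set \<Rightarrow> ('v set set \<Rightarrow> F3) \<Rightarrow> ('v set set \<Rightarrow> F3) \<Rightarrow> bool" where
  "homologous j S c d \<longleftrightarrow> c - d \<in> mbounds j S"

lemma homologous_refl [simp]: "homologous j S c c"
  by (simp add: homologous_def)

lemma homologous_sym: "homologous j S c d \<Longrightarrow> homologous j S d c"
  unfolding homologous_def using mbounds_uminus[of "c - d" j S] by simp

lemma homologous_trans [trans]: "homologous j S c d \<Longrightarrow> homologous j S d e \<Longrightarrow> homologous j S c e"
  unfolding homologous_def using mbounds_add[of "c - d" j S "d - e"] by simp

lemma homologous_add: "homologous j S c d \<Longrightarrow> homologous j S c' d' \<Longrightarrow> homologous j S (c + c') (d + d')"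
  unfolding homologous_def using mbounds_add[of "c - d" j S "c' - d'"] by (simp add: algebra_simps)

lemma homologous_uminus: "homologous j S c d \<Longrightarrow> homologous j S (- c) (- d)"
  unfolding homologous_def using mbounds_uminus[of "c - d" j S] by simp

lemma homologous_diff: "homologous j S c d \<Longrightarrow> homologous j S c' d' \<Longrightarrow> homologous j S (c - c') (d - d')"
  using homologous_add[of j S c d "- c'" "- d'"] homologous_uminus[of j S c' d'] by simp

lemma homologous_sum:
  "(\<And>i. i \<in> A \<Longrightarrow> homologous j S (c i) (d i)) \<Longrightarrow> homologous j S (\<Sum>i\<in>A. c i) (\<Sum>i\<in>A. d i)"
  unfolding homologous_def sum_subtractf[symmetric] by (rule mbounds_sum)

lemma homologousI: "b \<in> mchains (Suc j) S \<Longrightarrow> c = d + bd b \<Longrightarrow> homologous j S c d"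
  unfolding homologous_def by (rule mboundsI[of b]) auto

lemma homologousE:
  assumes "homologous j S c d"
  obtains b where "b \<in> mchains (Suc j) S" "c = d + bd b"
  using assms unfolding homologous_def mbounds_def by (metis (no_types, lifting) add.commute diff_add_cancel imageE)

text \<open>Two disjoint edges lie in a common simplex, so next to a cycle they may be exchanged.\<close>

lemma W_mcycles_homologous:
  assumes g: "g \<in> mcycles j S" and pts: "S \<subseteq> T" "T \<subseteq> V" "{x, y, u, v} \<subseteq> T - S"
    and dist: "x \<noteq> y" "u \<noteq> v" "{x, y} \<inter> {u, v} = {}"
  shows "homologous (Suc j) T (W x y g) (W u v g)"
proof (rule homologousI)
  show "W u v (W x y g) \<in> mchains (Suc (Suc j)) T"
    using g pts dist
    by (intro wedge_mchains[of "W x y g" "Suc j" "T - {u, v}"] W_mchains[of g j S] pairsI)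
       (auto simp: mcycles_def)
  have "{x, y} \<in> pairs V" "{u, v} \<in> pairs V" using pts dist by (auto intro!: pairs_V[of T])
  then show "W x y g = W u v g + bd (W u v (W x y g))"
    using g by (simp add: bd_wedge mcycles_def wedge_diff)
qed

lemma W_boundary_homologous:
  assumes c: "c \<in> mchains (Suc j) S" and pts: "S \<subseteq> T" "T \<subseteq> V" "{x, y} \<subseteq> T - S" "x \<noteq> y"
  shows "homologous (Suc j) T (W x y (bd c)) c"
proof (rule homologous_sym, rule homologousI)
  show "W x y c \<in> mchains (Suc (Suc j)) T"
    using c pts by (intro W_mchains[of c _ S]) auto
  have "{x, y} \<in> pairs V" using pts by (auto intro!: pairs_V[of T])
  then show "c = W x y (bd c) + bd (W x y c)" by (simp add: bd_wedge)
qed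

text \<open>With \<open>k + 1\<close> edges on \<open>3 k + 4\<close> vertices the bound above just fails. Fix three vertices \<open>a, b, c\<close>.
The cycle can still be pushed off \<open>a\<close>, and the coefficients of the edges at \<open>b\<close> can be pushed
off \<open>c\<close>. What remains are terms with one edge inside \<open>{a, b, c}\<close> times a cycle on \<open>S\<close>, since
any other edge at \<open>b\<close> or \<open>c\<close> may be exchanged for the edge formed by the other two of the three vertices.
The coefficients of \<open>{b, c}\<close>, \<open>{a, c}\<close>, \<open>{a, b}\<close> add up to a boundary, and so \<open>{a, b}\<close> can be
eliminated.\<close>

lemma bottom_cycles_decompose:
  assumes S: "S \<subseteq> V" "card S = 3 * k + 1" and V: "a \<in> V" "b \<in> V" "c \<in> V"
    and out: "a \<notin> S" "b \<notin> S" "c \<notin> S" and dist: "a \<noteq> b" "b \<noteq> c" "a \<noteq> c"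
    and z: "z \<in> mcycles (Suc k) (insert a (insert b (insert c S)))"
  obtains g g' where "g \<in> mcycles k S" "g' \<in> mcycles k S"
    "homologous (Suc k) (insert a (insert b (insert c S))) z ((W b c g - W a b g) + (W a c g' - W a b g'))"
proof -
  define T where "T = insert a (insert b (insert c S))"
  have TV: "T \<subseteq> V" and ST: "S \<subseteq> T" and abcT: "a \<in> T" "b \<in> T" "c \<in> T"
    using S V by (auto simp: T_def)
  have finS: "finite S" using finite_subset[OF S(1) finite_V] .
  have edges: "{a, b} \<in> pairs V" "{b, c} \<in> pairs V" "{a, c} \<in> pairs V"
    using V dist by (auto intro: pairsI)
  let ?h = "homologous (Suc k) T"
  have cardT: "card T = 3 * k + 4"
    using S finS out dist by (simp add: T_def)
  have zT: "z \<in> mcycles (Suc k) T" using z by (simp add: T_def)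
  \<comment> \<open>Push \<open>z\<close> off \<open>a\<close>, then expand it along \<open>b\<close>.\<close>
  obtain y where y: "y \<in> mchains (Suc (Suc k)) T" "z - bd y \<in> mcycles (Suc k) (T - {a})"
    by (rule push_off_vertex[OF TV _ abcT(1) zT]) (use cardT in auto)
  define z1 where "z1 = z - bd y"
  have z_z1: "?h z z1" using y(1) by (intro homologousI[of y]) (auto simp: z1_def)
  have Ta: "T - {a} = insert b (insert c S)" using out dist by (auto simp: T_def)
  have z1: "z1 \<in> mcycles (Suc k) (insert b (insert c S))"
    using y(2) unfolding z1_def Ta .
  have bcSV: "insert b (insert c S) \<subseteq> V" using S V by auto
  define c1 where "c1 = z1 - (\<Sum>p\<in>insert c S. W b p (R b p z1))"
  have bcS_b: "insert b (insert c S) - {b} = insert c S" using out dist by auto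
  have c1: "c1 \<in> mchains (Suc k) (insert c S)"
    using remove_vertex_mchains[of z1 "Suc k" "insert b (insert c S)" b] z1 bcSV
    unfolding bcS_b c1_def by (simp add: mcycles_def)
  define g where "g = R b c z1"
  have "insert b (insert c S) - {b, c} = S" using out by auto
  then have g: "g \<in> mcycles k S"
    using contr_mcycles[OF z1 bcSV, of "{b, c}"] by (simp add: g_def)
  have z1_eq: "z1 = c1 + W b c g + (\<Sum>p\<in>S. W b p (R b p z1))"
    using out finS by (simp add: c1_def g_def algebra_simps)
  have "\<forall>p\<in>S. \<exists>h. h \<in> mchains (Suc k) (insert c (S - {p})) \<and> R b p z1 - bd h \<in> mcycles k (S - {p})"
  proof
    fix p assume p: "p \<in> S"
    have "insert b (insert c S) - {b, p} = insert c (S - {p})" using out dist p by auto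
    then have "R b p z1 \<in> mcycles k (insert c (S - {p}))"
      using contr_mcycles[OF z1 bcSV, of "{b, p}"] by simp
    moreover have "3 * k + 1 \<le> card (insert c (S - {p}))" using p finS out S(2) by simp
    moreover have "insert c (S - {p}) \<subseteq> V" using S V by auto
    ultimately obtain h where "h \<in> mchains (Suc k) (insert c (S - {p}))"
      "R b p z1 - bd h \<in> mcycles k (insert c (S - {p}) - {c})"
      using push_off_vertex[of "insert c (S - {p})" k c "R b p z1"] by blast
    moreover have "insert c (S - {p}) - {c} = S - {p}" using out by auto
    ultimately show "\<exists>h. h \<in> mchains (Suc k) (insert c (S - {p})) \<and> R b p z1 - bd h \<in> mcycles k (S - {p})"
      by auto
  qed
  then obtain h where h: "\<And>p. p \<in> S \<Longrightarrow> h p \<in> mchains (Suc k) (insert c (S - {p}))"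
    "\<And>p. p \<in> S \<Longrightarrow> R b p z1 - bd (h p) \<in> mcycles k (S - {p})" by metis
  define f where "f p = R b p z1 - bd (h p)" for p
  have f: "f p \<in> mcycles k (S - {p})" if "p \<in> S" for p using h(2)[OF that] by (simp add: f_def)
  have step1: "?h (W b p (R b p z1)) (h p + W a c (f p))" if p: "p \<in> S" for p
  proof -
    have "W b p (R b p z1) = W b p (bd (h p)) + W b p (f p)"
      by (simp add: f_def flip: wedge_add)
    moreover have "?h (W b p (bd (h p))) (h p)"
      using h(1)[OF p] by (rule W_boundary_homologous) (use p out dist TV in \<open>auto simp: T_def\<close>)
    moreover have "?h (W b p (f p)) (W a c (f p))"
      using f[OF p] by (rule W_mcycles_homologous) (use p out dist TV in \<open>auto simp: T_def\<close>)
    ultimately show ?thesis by (simp add: homologous_add)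
  qed
  define c2 where "c2 = c1 + (\<Sum>p\<in>S. h p)"
  define g2 where "g2 = (\<Sum>p\<in>S. f p)"
  have c2: "c2 \<in> mchains (Suc k) (insert c S)"
    unfolding c2_def by (intro mchains_add c1 mchains_sum mchains_mono[OF h(1)]) auto
  have g2: "g2 \<in> mcycles k S"
    unfolding g2_def by (intro mcycles_sum mcycles_mono[OF f]) auto
  have "?h (\<Sum>p\<in>S. W b p (R b p z1)) (\<Sum>p\<in>S. h p + W a c (f p))"
    using step1 by (rule homologous_sum)
  also have "(\<Sum>p\<in>S. h p + W a c (f p)) = (\<Sum>p\<in>S. h p) + W a c g2"
    by (simp add: sum.distrib g2_def wedge_sum)
  finally have "?h ((c1 + W b c g) + (\<Sum>p\<in>S. W b p (R b p z1)))
    ((c1 + W b c g) + ((\<Sum>p\<in>S. h p) + W a c g2))"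
    by (intro homologous_add homologous_refl)
  then have "?h z1 ((c1 + W b c g) + ((\<Sum>p\<in>S. h p) + W a c g2))"
    by (simp only: z1_eq[symmetric])
  then have "?h z1 (c2 + W b c g + W a c g2)"
    by (simp add: c2_def algebra_simps)
  with z_z1 have z_z2: "?h z (c2 + W b c g + W a c g2)" by (rule homologous_trans)
  then obtain x where x: "x \<in> mchains (Suc (Suc k)) T" "z = c2 + W b c g + W a c g2 + bd x"
    by (rule homologousE)
  \<comment> \<open>Since \<open>g\<close> and \<open>g2\<close> are cycles, \<open>bd z = 0\<close> becomes a relation between them and \<open>c2\<close>.\<close>
  have "bd z = 0" using z by (simp add: mcycles_def)
  then have bd_c2: "bd c2 + g + g2 = 0"
    using g g2 edges by (simp add: x(2) bd_add bd_bd bd_wedge mcycles_def)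
  have cSV: "insert c S \<subseteq> V" and cS: "insert c S - {c} = S" using S V out by auto
  \<comment> \<open>Expand the rest along \<open>c\<close>.\<close>
  define c3 where "c3 = c2 - (\<Sum>p\<in>S. W c p (R c p c2))"
  have c3: "c3 \<in> mchains (Suc k) S"
    using remove_vertex_mchains[of c2 "Suc k" "insert c S" c] c2 cSV unfolding c3_def cS by simp
  have cp: "R c p c2 \<in> mcycles k (S - {p})" if p: "p \<in> S" for p
  proof -
    have e: "{c, p} \<in> pairs V" using p S V out by (intro pairsI) auto
    have notin: "{c, p} \<notin> pairs S" using out by (auto simp: pairs_eq)
    have "R c p (g + g2) = 0"
      by (rule contr_mchains_outside[OF _ notin]) (use mcycles_add[OF g g2] in \<open>auto simp: mcycles_def\<close>)
    moreover have "bd c2 = - (g + g2)" using bd_c2 unfolding add.assoc by (rule eq_neg_iff_add_eq_0[THEN iffD2])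
    ultimately have "R c p (bd c2) = 0" by (simp only: contr_minus minus_zero)
    then have "bd (R c p c2) = 0"
      using contr_bd[OF e, of c2] by simp
    moreover have "R c p c2 \<in> mchains k (insert c S - {c, p})"
      using c2 cSV by (rule contr_mchains)
    moreover have "insert c S - {c, p} = S - {p}" using out by auto
    ultimately show ?thesis by (simp add: mcycles_def)
  qed
  define g3 where "g3 = (\<Sum>p\<in>S. R c p c2)"
  have g3: "g3 \<in> mcycles k S"
    unfolding g3_def by (intro mcycles_sum mcycles_mono[OF cp]) auto
  have "?h (\<Sum>p\<in>S. W c p (R c p c2)) (\<Sum>p\<in>S. W a b (R c p c2))"
  proof (rule homologous_sum)
    fix p assume p: "p \<in> S"
    show "?h (W c p (R c p c2)) (W a b (R c p c2))"
      using cp[OF p] by (rule W_mcycles_homologous) (use p out dist TV in \<open>auto simp: T_def\<close>)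
  qed
  then have "?h (\<Sum>p\<in>S. W c p (R c p c2)) (W a b g3)" by (simp add: g3_def wedge_sum)
  then have c2_h: "?h c2 (c3 + W a b g3)"
    using homologous_add[of "Suc k" T c3 c3] by (fastforce simp: c3_def)
  have "bd (\<Sum>p\<in>S. W c p (R c p c2)) = g3"
    unfolding g3_def bd_sum
  proof (rule sum.cong)
    fix p assume p: "p \<in> S"
    have e: "{c, p} \<in> pairs V" using p S V out by (intro pairsI) auto
    show "bd (W c p (R c p c2)) = R c p c2" using cp[OF p] e by (simp add: bd_wedge mcycles_def)
  qed simp
  then have bd_c3: "bd c3 = - (g + g2) - g3"
    using bd_c2[unfolded add.assoc, THEN eq_neg_iff_add_eq_0[THEN iffD2]] by (simp only: c3_def bd_diff)
  then have g3_eq: "g3 = - (g + g2) - bd c3" by simp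
  have "?h (W a b (bd c3)) c3"
    using c3 by (rule W_boundary_homologous) (use out dist TV in \<open>auto simp: T_def\<close>)
  then have "?h (c3 + W a b g3) (c3 + (- W a b (g + g2) - c3))"
    unfolding g3_eq wedge_diff wedge_minus by (intro homologous_add homologous_diff) auto
  with c2_h have "?h c2 (- W a b (g + g2))" by (auto intro: homologous_trans)
  then have "?h (c2 + (W b c g + W a c g2)) (- W a b (g + g2) + (W b c g + W a c g2))"
    by (intro homologous_add) auto
  with z_z2 have "?h z ((W b c g - W a b g) + (W a c g2 - W a b g2))"
    by (auto simp: wedge_add algebra_simps intro: homologous_trans)
  then show ?thesis using that g g2 by (simp add: T_def)
qed

end

section \<open>Products with a triangle\<close>

lemma two_eq_neg: "c + c = - c" for c :: "'a \<Rightarrow> F3"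
  using three_zero[of c] by (simp add: eq_neg_iff_add_eq_0)

context ordered_matchings
begin

text \<open>Multiplication by the difference of the two edges of the path \<open>a\<close>-\<open>b\<close>-\<open>c\<close>, a reduced 0-cycle, and by
the sum of the three edges of a triangle. The latter sends cycles to cycles only because the
augmentation of the triangle is 3.\<close>

definition path :: "'v \<Rightarrow> 'v \<Rightarrow> 'v \<Rightarrow> ('v set set \<Rightarrow> 'k::comm_ring_1) \<Rightarrow> 'v set set \<Rightarrow> 'k" where
  "path a b c z = W a b z - W b c z"

definition tri :: "'v \<Rightarrow> 'v \<Rightarrow> 'v \<Rightarrow> ('v set set \<Rightarrow> 'k::comm_ring_1) \<Rightarrow> 'v set set \<Rightarrow> 'k" where
  "tri p q s z = W p q z + W q s z + W p s z"

lemma path_add: "path a b c (x + y) = path a b c x + path a b c y"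
  and path_rev: "path c b a x = - path a b c x"
  by (simp_all add: path_def wedge_add wedge_minus insert_commute)

lemma tri_add: "tri p q s (x + y) = tri p q s x + tri p q s y"
  by (simp add: tri_def wedge_add)

lemma bd_path:
  assumes "a \<in> V" "b \<in> V" "c \<in> V" "a \<noteq> b" "b \<noteq> c"
  shows "bd (path a b c z) = - path a b c (bd z)"
  using assms pairsI[of a V b] pairsI[of b V c] by (simp add: path_def bd_diff bd_wedge)

lemma bd_tri:
  fixes z :: "'v set set \<Rightarrow> F3"
  assumes "p \<in> V" "q \<in> V" "s \<in> V" "p \<noteq> q" "q \<noteq> s" "p \<noteq> s"
  shows "bd (tri p q s z) = - tri p q s (bd z)"
proof -
  have "bd (tri p q s z) = (z + z + z) - tri p q s (bd z)"
    using assms pairsI[of p V q] pairsI[of q V s] pairsI[of p V s]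
    by (simp add: tri_def bd_add bd_wedge)
  then show ?thesis by (simp only: three_zero diff_0)
qed

lemma tri_path:
  assumes "a \<in> V" "b \<in> V" "c \<in> V" "a \<noteq> b" "b \<noteq> c"
    and "p \<in> V" "q \<in> V" "s \<in> V" "p \<noteq> q" "q \<noteq> s" "p \<noteq> s"
  shows "tri p q s (path a b c z) = - path a b c (tri p q s z)"
proof -
  have "W u v (path a b c z) = - path a b c (W u v z)" if "{u, v} \<in> pairs V" for u v
    using assms pairsI[of a V b] pairsI[of b V c] that wedge_wedge[of "{u, v}" "{a, b}" z]
      wedge_wedge[of "{u, v}" "{b, c}" z]
    by (simp add: path_def wedge_diff)
  then have "tri p q s (path a b c z) = - path a b c (W p q z) - path a b c (W q s z) - path a b c (W p s z)"
    using assms by (simp add: tri_def pairsI)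
  then show ?thesis by (simp add: tri_def path_add)
qed

lemma path_mchains:
  assumes "z \<in> mchains j S" "S \<subseteq> T" "T \<subseteq> V" "{a, b, c} \<subseteq> T - S" "a \<noteq> b" "b \<noteq> c"
  shows "path a b c z \<in> mchains (Suc j) T"
  unfolding path_def using assms(2-) by (intro mchains_diff W_mchains[OF assms(1)]) auto

lemma tri_mchains:
  assumes "z \<in> mchains j S" "S \<subseteq> T" "T \<subseteq> V" "{p, q, s} \<subseteq> T - S" "p \<noteq> q" "q \<noteq> s" "p \<noteq> s"
  shows "tri p q s z \<in> mchains (Suc j) T"
  unfolding tri_def using assms(2-) by (intro mchains_add W_mchains[OF assms(1)]) auto

lemma tri_mcycles:
  assumes "z \<in> mcycles j S" "S \<subseteq> T" "T \<subseteq> V" "{p, q, s} \<subseteq> T - S" "p \<noteq> q" "q \<noteq> s" "p \<noteq> s"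
  shows "tri p q s z \<in> mcycles (Suc j) T"
proof -
  have "bd (tri p q s z) = - tri p q s (bd z)" using assms by (intro bd_tri) auto
  moreover have "tri p q s 0 = 0" by (simp add: tri_def)
  ultimately show ?thesis using assms tri_mchains[of z j S T p q s] by (simp add: mcycles_def)
qed

lemma path_homologous:
  assumes h: "homologous j S x y" and T: "S \<subseteq> T" "T \<subseteq> V" "{a, b, c} \<subseteq> T - S" "a \<noteq> b" "b \<noteq> c"
  shows "homologous (Suc j) T (path a b c x) (path a b c y)"
proof -
  obtain u where u: "u \<in> mchains (Suc j) S" "x = y + bd u" using h by (rule homologousE)
  have "bd (path a b c u) = - path a b c (bd u)" using T by (intro bd_path) auto
  then have "path a b c x = path a b c y + bd (- path a b c u)"
    by (simp add: u(2) path_add bd_minus)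
  then show ?thesis
    using u T by (intro homologousI[of "- path a b c u"] mchains_uminus path_mchains[of u _ S]) auto
qed

lemma tri_homologous:
  assumes h: "homologous j S x y"
    and T: "S \<subseteq> T" "T \<subseteq> V" "{p, q, s} \<subseteq> T - S" "p \<noteq> q" "q \<noteq> s" "p \<noteq> s"
  shows "homologous (Suc j) T (tri p q s x) (tri p q s y)"
proof -
  obtain u where u: "u \<in> mchains (Suc j) S" "x = y + bd u" using h by (rule homologousE)
  have "bd (tri p q s u) = - tri p q s (bd u)" using T by (intro bd_tri) auto
  then have "tri p q s x = tri p q s y + bd (- tri p q s u)"
    by (simp add: u(2) tri_add bd_minus)
  then show ?thesis
    using u T by (intro homologousI[of "- tri p q s u"] mchains_uminus tri_mchains[of u _ S]) auto
qed

lemma tri_exchange: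
  assumes "y \<in> mcycles j S" "S \<subseteq> T" "T \<subseteq> V" "{p, q, s, v} \<subseteq> T - S" "distinct [p, q, s, v]"
  shows "homologous (Suc j) T (tri p q s y) (tri p q v y)"
proof -
  have "homologous (Suc j) T (W q s y) (W p v y)" "homologous (Suc j) T (W p s y) (W q v y)"
    by (rule W_mcycles_homologous[OF assms(1-3)]; use assms(4,5) in auto)+
  then have "homologous (Suc j) T (W p q y + W q s y + W p s y) (W p q y + W p v y + W q v y)"
    by (intro homologous_add homologous_refl)
  then show ?thesis unfolding tri_def by (simp only: ac_simps)
qed

lemma path_exchange:
  assumes "y \<in> mcycles j S" "S \<subseteq> T" "T \<subseteq> V" "{a, b, c, v} \<subseteq> T - S" "distinct [a, b, c, v]"
  shows "homologous (Suc j) T (path a b c y) (path b a v y)"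
proof -
  have "homologous (Suc j) T (W b c y) (W a v y)"
    by (rule W_mcycles_homologous[OF assms(1-3)]; use assms(4,5) in auto)
  then have "homologous (Suc j) T (W a b y - W b c y) (W a b y - W a v y)"
    by (intro homologous_diff homologous_refl)
  then show ?thesis unfolding path_def by (simp only: insert_commute[of b a])
qed

text \<open>On seven vertices the product of a path and a triangle hardly depends on the chosen points: a vertex
of the triangle may be replaced by the free vertex \<open>v\<close>, and \<open>path a b c\<close> by \<open>path b a v\<close>. Combining
these moves, the third vertex of the path trades places with a vertex of the triangle.\<close>

lemma path_tri_exchange:
  assumes g: "g \<in> mcycles 0 {}" and T: "T \<subseteq> V" "{a, b, c, p, q, s, v} \<subseteq> T"
    and dist: "distinct [a, b, c, p, q, s, v]"
  shows "homologous (Suc (Suc 0)) T (path a b c (tri p q s g)) (path a b s (tri p q c g))"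
proof -
  let ?h = "homologous (Suc (Suc 0)) T"
  have "tri p q s g \<in> mcycles (Suc 0) {p, q, s}" "tri p q c g \<in> mcycles (Suc 0) {p, q, c}"
    by (rule tri_mcycles[OF g]; use T dist in auto)+
  note cyc = this
  have "?h (path a b c (tri p q s g)) (path b a v (tri p q s g))"
    by (rule path_exchange[OF cyc(1)]) (use T dist in auto)
  also have "?h \<dots> (path b a v (tri p q c g))"
  proof (rule path_homologous)
    show "homologous (Suc 0) (T - {b, a, v}) (tri p q s g) (tri p q c g)"
      by (rule tri_exchange[OF g]) (use T dist in auto)
  qed (use T dist in auto)
  also have "?h \<dots> (path a b s (tri p q c g))"
    by (rule path_exchange[OF cyc(2)]) (use T dist in auto)
  finally show ?thesis .
qed

text \<open>Three such exchanges, applied to either end of the path, reverse the path and restore the triangle.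
Thus the class equals its own negative, and it vanishes because 2 is invertible.\<close>

lemma path_tri_bound:
  assumes g: "g \<in> mcycles 0 {}" and T: "T \<subseteq> V" "{a, b, c, p, q, s, v} \<subseteq> T"
    and dist: "distinct [a, b, c, p, q, s, v]"
  shows "path a b c (tri p q s g) \<in> mbounds (Suc (Suc 0)) T"
proof -
  let ?h = "homologous (Suc (Suc 0)) T" and ?f = "path a b c (tri p q s g)"
  have "?h ?f (path a b s (tri p q c g))"
    by (rule path_tri_exchange[OF g, where v = v]) (use T dist in auto)
  also have "path a b s (tri p q c g) = - path s b a (tri p q c g)" by (rule path_rev)
  also have "?h \<dots> (- path s b c (tri p q a g))"
    by (rule homologous_uminus, rule path_tri_exchange[OF g, where v = v]) (use T dist in auto)
  also have "- path s b c (tri p q a g) = path c b s (tri p q a g)" by (simp add: path_def insert_commute)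
  also have "?h \<dots> (path c b a (tri p q s g))"
    by (rule path_tri_exchange[OF g, where v = v]) (use T dist in auto)
  also have "path c b a (tri p q s g) = - ?f" by (rule path_rev)
  finally have "?h ?f (- ?f)" .
  then have "?f + ?f \<in> mbounds (Suc (Suc 0)) T" by (simp only: homologous_def diff_minus_eq_add)
  then show ?thesis using mbounds_uminus[of "- ?f"] by (simp only: two_eq_neg minus_minus)
qed

text \<open>By the decomposition of bottom cycles and anticommutation, a statement about \<open>tri p q s y\<close> for all
bottom cycles \<open>y\<close> reduces to products with a path.\<close>

lemma tri_mcycles_bound_step:
  assumes T: "T \<subseteq> V" "card T = 3 * Suc k + 1" and y: "y \<in> mcycles (Suc k) T"
    and pqs: "{p, q, s} \<subseteq> V - T" "p \<noteq> q" "q \<noteq> s" "p \<noteq> s"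
    and S_step: "\<And>S a b c g. S \<subseteq> V \<Longrightarrow> card S = 3 * k + 1 \<Longrightarrow> T = insert a (insert b (insert c S)) \<Longrightarrow>
      distinct [a, b, c] \<Longrightarrow> {a, b, c} \<inter> S = {} \<Longrightarrow> g \<in> mcycles k S \<Longrightarrow>
      path a b c (tri p q s g) \<in> mbounds (Suc (Suc k)) (insert p (insert q (insert s T)))"
  shows "tri p q s y \<in> mbounds (Suc (Suc k)) (insert p (insert q (insert s T)))"
proof -
  let ?U = "insert p (insert q (insert s T))"
  have finT: "finite T" using finite_subset[OF T(1) finite_V] .
  obtain D where D: "D \<subseteq> T" "card D = 3"
    using obtain_subset_with_card_n[of 3 T] T(2) by auto
  then obtain a b c where abc: "D = {a, b, c}" "a \<noteq> b" "b \<noteq> c" "a \<noteq> c"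
    by (auto simp: card_3_iff)
  define S where "S = T - {a, b, c}"
  have S: "T = insert a (insert b (insert c S))" "S \<subseteq> V" "a \<notin> S" "b \<notin> S" "c \<notin> S"
    using D abc T by (auto simp: S_def)
  have cardS: "card S = 3 * k + 1"
    using card_Diff_subset[of D T] D abc(1) finT T(2) by (simp add: S_def finite_subset[OF D(1) finT])
  have V: "a \<in> V" "b \<in> V" "c \<in> V" using D abc T by auto
  obtain g g' where g: "g \<in> mcycles k S" "g' \<in> mcycles k S"
    "homologous (Suc k) T y ((W b c g - W a b g) + (W a c g' - W a b g'))"
    using bottom_cycles_decompose[OF S(2) cardS V S(3-5) abc(2-4), of y] y S(1) by metis
  have "homologous (Suc k) T y (path c b a g + path c a b g')"
    using g(3) by (simp only: path_def insert_commute)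
  then have h: "homologous (Suc (Suc k)) ?U (tri p q s y) (tri p q s (path c b a g + path c a b g'))"
    by (rule tri_homologous) (use T pqs in auto)
  have tp: "tri p q s (path c b a g) = - path c b a (tri p q s g)"
    "tri p q s (path c a b g') = - path c a b (tri p q s g')"
    by (rule tri_path; use V abc pqs in auto)+
  have "path c b a (tri p q s g) \<in> mbounds (Suc (Suc k)) ?U"
    by (rule S_step[OF S(2) cardS _ _ _ g(1)]) (use S abc in auto)
  moreover have "path c a b (tri p q s g') \<in> mbounds (Suc (Suc k)) ?U"
    by (rule S_step[OF S(2) cardS _ _ _ g(2)]) (use S abc in auto)
  ultimately have "tri p q s (path c b a g + path c a b g') \<in> mbounds (Suc (Suc k)) ?U"
    unfolding tri_add tp by (intro mbounds_add mbounds_uminus)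
  then show ?thesis
    using h mbounds_add[of "tri p q s y - tri p q s (path c b a g + path c a b g')"]
    unfolding homologous_def by fastforce
qed

text \<open>Splitting one path after the other off \<open>y\<close> leads down to seven vertices. The condition that \<open>y\<close> has at
least one edge is essential: on four vertices a triangle is a nonbounding cycle over \<open>F3\<close>.\<close>

theorem tri_mcycles_bound:
  "T \<subseteq> V \<Longrightarrow> card T = 3 * Suc k + 1 \<Longrightarrow> y \<in> mcycles (Suc k) T \<Longrightarrow>
    {p, q, s} \<subseteq> V - T \<Longrightarrow> p \<noteq> q \<Longrightarrow> q \<noteq> s \<Longrightarrow> p \<noteq> s \<Longrightarrow>
    tri p q s y \<in> mbounds (Suc (Suc k)) (insert p (insert q (insert s T)))"
proof (induction k arbitrary: T y)
  case (0 T y)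
  show ?case
  proof (rule tri_mcycles_bound_step[OF 0])
    fix S a b c g
    assume S: "S \<subseteq> V" "card S = 3 * 0 + 1" "T = insert a (insert b (insert c S))"
      "distinct [a, b, c]" "{a, b, c} \<inter> S = {}" and g: "g \<in> mcycles 0 S"
    obtain v where v: "S = {v}" using S(2) by (auto simp: card_1_singleton_iff)
    have "g \<in> mcycles 0 {}" using g mchains_0_mono[OF _ S(1)] by (auto simp: mcycles_def)
    then show "path a b c (tri p q s g) \<in> mbounds (Suc (Suc 0)) (insert p (insert q (insert s T)))"
      by (rule path_tri_bound[where v = v]) (use S v 0 in auto)
  qed
next
  case (Suc k T y)
  show ?case
  proof (rule tri_mcycles_bound_step[OF Suc.prems])
    fix S a b c g
    assume S: "S \<subseteq> V" "card S = 3 * Suc k + 1" "T = insert a (insert b (insert c S))"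
      "distinct [a, b, c]" "{a, b, c} \<inter> S = {}" and g: "g \<in> mcycles (Suc k) S"
    let ?U = "insert p (insert q (insert s S))"
    have "tri p q s g \<in> mbounds (Suc (Suc k)) ?U"
      by (rule Suc.IH[OF S(1,2) g]) (use S Suc.prems in auto)
    then have "homologous (Suc (Suc k)) ?U (tri p q s g) 0" by (simp add: homologous_def)
    then have "homologous (Suc (Suc (Suc k))) (insert p (insert q (insert s T)))
      (path a b c (tri p q s g)) (path a b c 0)"
      by (rule path_homologous) (use S Suc.prems in auto)
    then show "path a b c (tri p q s g) \<in> mbounds (Suc (Suc (Suc k))) (insert p (insert q (insert s T)))"
      by (simp add: homologous_def path_def)
  qed
qed

end

section \<open>The inductive step\<close>

context ordered_matchings
begin

text \<open>The part of a chain supported on \<open>S\<close>. It does not commute with the boundary: edges leaving \<open>S\<close>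
contribute exactly the contraction terms in \<open>proj_bd_one\<close> and \<open>proj_bd_two\<close>.\<close>

definition proj :: "'v set \<Rightarrow> ('v set set \<Rightarrow> 'k::comm_ring_1) \<Rightarrow> 'v set set \<Rightarrow> 'k" where
  "proj S c = (\<lambda>\<sigma>. if \<sigma> \<subseteq> pairs S then c \<sigma> else 0)"

lemma proj_zero [simp]: "proj S 0 = 0"
  and proj_add: "proj S (c + d) = proj S c + proj S d"
  and proj_minus: "proj S (- c) = - proj S c"
  by (simp_all add: proj_def fun_eq_iff)

lemma proj_sum: "proj S (\<Sum>i\<in>A. c i) = (\<Sum>i\<in>A. proj S (c i))"
  by (induction A rule: infinite_finite_induct)
     (simp_all only: sum.infinite sum.empty sum.insert proj_zero proj_add if_True not_False_eq_True)

lemma proj_id: "c \<in> mchains j S \<Longrightarrow> proj S c = c"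
  unfolding proj_def mchains_def matchings_of_size_def by (rule ext) (simp, metis)

lemma proj_proj: "S \<subseteq> T \<Longrightarrow> proj S (proj T c) = proj S c"
  unfolding proj_def using pairs_mono[of S T] by (intro ext) auto

lemma contr_proj: "e \<in> pairs S \<Longrightarrow> contr e (proj S c) = proj S (contr e c)"
  unfolding proj_def contr_def by (intro ext) simp

lemma contr_proj_outside: "e \<notin> pairs S \<Longrightarrow> contr e (proj S c) = 0"
  unfolding proj_def contr_def by (intro ext) simp

lemma proj_mchains:
  assumes "c \<in> mchains j T" "T \<inter> S \<subseteq> U"
  shows "proj S c \<in> mchains j U"
  unfolding mchains_def
proof safe
  fix \<sigma> assume "proj S c \<sigma> \<noteq> 0"
  then have "\<sigma> \<in> matchings_of_size j T" "\<sigma> \<subseteq> pairs S"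
    using assms(1) by (auto simp: proj_def mchains_def split: if_splits)
  moreover have "pairs T \<inter> pairs S \<subseteq> pairs U"
    using assms(2) by (auto simp: pairs_eq)
  ultimately show "\<sigma> \<in> matchings_of_size j U"
    by (auto simp: matchings_of_size_def)
qed

lemma proj_bd_one:
  assumes x: "x \<in> mchains j (insert w S)" and V: "insert w S \<subseteq> V" and w: "w \<notin> S"
  shows "proj S (bd x) = bd (proj S x) + (\<Sum>p\<in>S. proj S (R w p x))"
proof -
  let ?E = "pairs S" and ?F = "(\<lambda>p. {w, p}) ` S"
  have "finite S" using V finite_V finite_subset[of S V] by simp
  then have fin: "finite ?E" "finite ?F" "finite (pairs V)"
    using finite_V by (simp_all add: finite_pairs)
  have sub: "?E \<union> ?F \<subseteq> pairs V" "?E \<inter> ?F = {}"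
    using V w pairs_mono[of S V] by (auto intro!: pairsI dest: pairs_subset)
  have split: "pairs (insert w S) = ?E \<union> ?F"
    using w by (auto simp: pairs_def)
  have "proj S (bd x) = (\<Sum>e\<in>pairs V. proj S (contr e x))"
    by (simp add: bd_def proj_sum)
  also have "\<dots> = (\<Sum>e\<in>?E \<union> ?F. proj S (contr e x))"
    using contr_mchains_outside[OF x] split sub fin by (intro sum.mono_neutral_right) auto
  also have "\<dots> = (\<Sum>e\<in>?E. proj S (contr e x)) + (\<Sum>e\<in>?F. proj S (contr e x))"
    using sub fin by (intro sum.union_disjoint) auto
  also have "(\<Sum>e\<in>?F. proj S (contr e x)) = (\<Sum>p\<in>S. proj S (R w p x))"
    by (subst sum.reindex) (auto simp: inj_on_def doubleton_eq_iff)
  also have "(\<Sum>e\<in>?E. proj S (contr e x)) = (\<Sum>e\<in>?E. contr e (proj S x))"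
    by (intro sum.cong) (auto simp: contr_proj)
  also have "\<dots> = bd (proj S x)"
    unfolding bd_def using sub fin contr_proj_outside[of _ S x] by (intro sum.mono_neutral_left) auto
  finally show ?thesis .
qed

lemma proj_bd_two:
  assumes x: "x \<in> mchains j (insert b (insert c S))" and V: "insert b (insert c S) \<subseteq> V"
    and out: "b \<notin> S" "c \<notin> S" "b \<noteq> c"
  shows "proj S (bd x) = bd (proj S x) + (\<Sum>p\<in>S. proj S (R c p x)) + proj S (R b c x)
    + (\<Sum>p\<in>S. proj S (R b p x))"
proof -
  let ?T = "insert c S"
  have fin: "finite S" using V finite_subset[OF _ finite_V, of S] by simp
  have "proj ?T (bd x) = bd (proj ?T x) + (\<Sum>p\<in>?T. proj ?T (R b p x))"
    by (rule proj_bd_one[OF x V]) (use out in auto)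
  then have "proj S (proj ?T (bd x)) = proj S (bd (proj ?T x)) + (\<Sum>p\<in>?T. proj S (proj ?T (R b p x)))"
    by (simp only: proj_add proj_sum)
  then have "proj S (bd x) = proj S (bd (proj ?T x)) + (\<Sum>p\<in>?T. proj S (R b p x))"
    by (simp only: proj_proj[OF subset_insertI])
  note 1 = this
  have y: "proj ?T x \<in> mchains j ?T" using x by (rule proj_mchains) auto
  have "proj S (bd (proj ?T x)) = bd (proj S (proj ?T x)) + (\<Sum>p\<in>S. proj S (R c p (proj ?T x)))"
    by (rule proj_bd_one[OF y]) (use V out in auto)
  also have "(\<Sum>p\<in>S. proj S (R c p (proj ?T x))) = (\<Sum>p\<in>S. proj S (R c p x))"
  proof (rule sum.cong)
    fix p assume p: "p \<in> S"
    then have "{c, p} \<in> pairs ?T" using out by (intro pairsI) auto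
    then show "proj S (R c p (proj ?T x)) = proj S (R c p x)"
      by (simp only: contr_proj proj_proj[OF subset_insertI])
  qed simp
  also have "proj S (proj ?T x) = proj S x" by (rule proj_proj) auto
  finally have 2: "proj S (bd (proj ?T x)) = bd (proj S x) + (\<Sum>p\<in>S. proj S (R c p x))" .
  have 3: "(\<Sum>p\<in>?T. proj S (R b p x)) = proj S (R b c x) + (\<Sum>p\<in>S. proj S (R b p x))"
    by (rule sum.insert[OF fin out(2)])
  show ?thesis by (simp only: 1 2 3 add.assoc)
qed

lemma contr_wedge_outside:
  assumes "z \<in> mchains j S" "e \<in> pairs V" "f \<in> pairs V" "e \<notin> pairs S"
  shows "contr e (wedge f z) = (if e = f then z else 0)"
proof -
  have "contr e z = 0" by (rule contr_mchains_outside[OF assms(1,4)])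
  then show ?thesis using assms(2,3) by (cases "e = f") (simp_all add: contr_wedge contr_wedge_self)
qed

text \<open>Take the part of \<open>x\<close> with an edge from \<open>u\<close> to \<open>p\<close> and an edge from \<open>v\<close> to \<open>q\<close>. By the cone
formula with apex edge \<open>{p, q}\<close> it is homologous to \<open>{p, q}\<close> times its own boundary, and that boundary
consists of the parts of \<open>x\<close> in which \<open>w\<close> is matched as well.\<close>

lemma two_legs:
  fixes x :: "'v set set \<Rightarrow> F3"
  assumes S: "S \<subseteq> V" and V: "{u, v, w} \<subseteq> V - S" and dist: "u \<noteq> v" "v \<noteq> w" "u \<noteq> w"
    and x: "x \<in> mchains (Suc (Suc (Suc k))) (insert u (insert v (insert w S)))"
    and pq: "p \<in> S" "q \<in> S" and z: "R v q (R u p (bd x)) = 0"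
  shows "homologous (Suc k) S (proj S (R v q (R u p x)))
    (- (\<Sum>s\<in>S. W p q (proj S (R w s (R v q (R u p x))))))"
proof -
  let ?T = "insert u (insert v (insert w S))"
  have TV: "?T \<subseteq> V" using S V by auto
  define y where "y = R v q (R u p x)"
  have x1: "R u p x \<in> mchains (Suc (Suc k)) (?T - {u, p})" by (rule contr_mchains[OF x TV])
  have y: "y \<in> mchains (Suc k) (?T - {u, p} - {v, q})"
    unfolding y_def by (rule contr_mchains[OF x1]) (use TV in auto)
  show ?thesis
  proof (cases "p = q")
    case True
    have "y = 0"
      unfolding y_def True by (rule contr_mchains_outside[OF x1[unfolded True]]) (auto simp: pairs_eq)
    then show ?thesis unfolding y_def[symmetric] by (simp only: proj_zero contr_zero wedge_zero sum.neutral_const minus_zero homologous_refl)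
  next
    case False
    have e: "{u, p} \<in> pairs V" "{v, q} \<in> pairs V" "{p, q} \<in> pairs V"
      using S V pq False by (auto intro!: pairsI)
    have "bd y = R v q (R u p (bd x))"
      by (simp only: y_def contr_bd[OF e(1)] contr_bd[OF e(2)] contr_minus minus_minus)
    then have bdy: "bd y = 0" using z by simp
    have "y \<in> mchains (Suc k) (insert w S)"
      by (rule mchains_mono[OF y]) (use V dist in auto)
    then have "proj S (bd y) = bd (proj S y) + (\<Sum>s\<in>S. proj S (R w s y))"
      by (rule proj_bd_one) (use S V in auto)
    then have "bd (proj S y) + (\<Sum>s\<in>S. proj S (R w s y)) = 0" by (simp only: bdy proj_zero)
    then have bdn: "bd (proj S y) = - (\<Sum>s\<in>S. proj S (R w s y))" by (rule eq_neg_iff_add_eq_0[THEN iffD2])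
    have n: "proj S y \<in> mchains (Suc k) (S - {p, q})"
      using y by (rule proj_mchains) (use V in auto)
    have "proj S y = bd (W p q (proj S y)) + W p q (bd (proj S y))"
      using e by (simp add: bd_wedge)
    also have "\<dots> = - (\<Sum>s\<in>S. W p q (proj S (R w s y))) + bd (W p q (proj S y))"
      by (simp only: bdn wedge_minus wedge_sum add.commute)
    finally show ?thesis
      unfolding y_def[symmetric]
      by (rule homologousI[rotated]) (rule W_mchains[OF n]; use pq False S in auto)
  qed
qed

text \<open>The inductive step. Let \<open>bd x\<close> be the product of the path \<open>a\<close>-\<open>b\<close>-\<open>c\<close> with \<open>z\<close>. Give \<open>a, b, c\<close> the
weights 1, 0, -1, and let \<open>X\<close> be the sum, with these weights, of the parts of \<open>x\<close> in which one of the three vertices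
is matched into \<open>S\<close> or is missed by an edge joining the other two. Its boundary is \<open>- z\<close>
plus terms in which two of the three vertices are matched into \<open>S\<close>, each with the difference of two
weights as coefficient. By the previous lemma these become terms in which \<open>a, b, c\<close> are matched to
\<open>p, q, s\<close>. As the three cyclic differences of the weights agree modulo 3, the edges \<open>{p, q}\<close>,
\<open>{q, s}\<close>, \<open>{p, s}\<close> all occur with coefficient 1, that is, as a triangle.\<close>

lemma path_bound_step:
  fixes z :: "'v set set \<Rightarrow> F3"
  assumes S: "S \<subseteq> V" and V: "{a, b, c} \<subseteq> V - S" and dist: "a \<noteq> b" "b \<noteq> c" "a \<noteq> c"
    and z: "z \<in> mcycles (Suc k) S"
    and bound: "path a b c z \<in> mbounds (Suc (Suc k)) (insert a (insert b (insert c S)))"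
  obtains Y where
    "\<And>p q s. p \<in> S \<Longrightarrow> q \<in> S \<Longrightarrow> s \<in> S \<Longrightarrow> distinct [p, q, s] \<Longrightarrow> Y p q s \<in> mcycles k (S - {p, q, s})"
    "\<And>p q s. p \<in> S \<Longrightarrow> q \<in> S \<Longrightarrow> s \<in> S \<Longrightarrow> \<not> distinct [p, q, s] \<Longrightarrow> Y p q s = 0"
    "homologous (Suc k) S z (\<Sum>p\<in>S. \<Sum>q\<in>S. \<Sum>s\<in>S. tri p q s (Y p q s))"
proof -
  let ?T = "insert a (insert b (insert c S))"
  have TV: "?T \<subseteq> V" using S V by auto
  obtain x where x: "x \<in> mchains (Suc (Suc (Suc k))) ?T" "bd x = path a b c z"
    using bound by (auto simp: mbounds_def)
  have zc: "z \<in> mchains (Suc k) S" using z by (simp add: mcycles_def)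
  have ab: "{a, b} \<in> pairs V" "{b, c} \<in> pairs V" using V dist by (auto intro!: pairsI)
  have R_bd: "contr e (bd x) = (if e = {a, b} then z else 0) - (if e = {b, c} then z else 0)"
    if "e \<in> pairs V" "e \<notin> pairs S" for e
    using that ab zc by (simp add: x(2) path_def contr_diff contr_wedge_outside)
  have legs: "{u, p} \<in> pairs V" "{u, p} \<notin> pairs S" "{u, p} \<noteq> {a, b}" "{u, p} \<noteq> {b, c}"
    if "u \<in> {a, b, c}" "p \<in> S" for u p
  proof -
    show "{u, p} \<in> pairs V" using that V S by (intro pairsI) auto
    show "{u, p} \<notin> pairs S" using that V pairs_subset[of "{u, p}" S] by auto
  qed (use that V in \<open>auto simp: doubleton_eq_iff\<close>)
  have leg0: "R u p (bd x) = 0" if "u \<in> {a, b, c}" "p \<in> S" for u p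
    using R_bd[OF legs(1,2)[OF that]] legs(3,4)[OF that] by simp
  have nab: "{a, b} \<notin> pairs S" "{b, c} \<notin> pairs S" "{a, b} \<noteq> {b, c}" "{b, c} \<noteq> {a, b}"
    using V dist by (auto simp: pairs_eq doubleton_eq_iff)
  have Rab: "R a b (bd x) = z" using R_bd[OF ab(1) nab(1)] nab(3) by simp
  have Rbc: "R b c (bd x) = - z" using R_bd[OF ab(2) nab(2)] nab(4) by simp
  define P where "P = (proj S :: ('v set set \<Rightarrow> F3) \<Rightarrow> _)"
  have P_minus: "P (- d) = - P d" for d by (simp add: P_def proj_minus)
  define Y where "Y p q s = P (R c s (R b q (R a p x)))" for p q s
  \<comment> \<open>Boundaries of the parts of \<open>x\<close> with a single edge meeting \<open>{a, b, c}\<close>.\<close>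
  have P_z: "P z = z" unfolding P_def using zc by (rule proj_id)
  have 1: "bd (P (R b c x)) = z - (\<Sum>p\<in>S. P (R a p (R b c x)))"
  proof -
    have "R b c x \<in> mchains (Suc (Suc k)) (insert a S)"
      by (rule mchains_mono[OF contr_mchains[OF x(1) TV]]) auto
    then have "P (bd (R b c x)) = bd (P (R b c x)) + (\<Sum>p\<in>S. P (R a p (R b c x)))"
      unfolding P_def by (rule proj_bd_one) (use TV V in auto)
    moreover have "bd (R b c x) = z"
      using contr_bd[OF ab(2), of x] by (simp only: Rbc neg_equal_iff_equal)
    ultimately show ?thesis by (simp only: P_z eq_diff_eq)
  qed
  have 2: "bd (P (R a b x)) = - z - (\<Sum>p\<in>S. P (R c p (R a b x)))"
  proof -
    have "R a b x \<in> mchains (Suc (Suc k)) (insert c S)"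
      by (rule mchains_mono[OF contr_mchains[OF x(1) TV]]) auto
    then have "P (bd (R a b x)) = bd (P (R a b x)) + (\<Sum>p\<in>S. P (R c p (R a b x)))"
      unfolding P_def by (rule proj_bd_one) (use TV V in auto)
    moreover have "bd (R a b x) = - z"
      using contr_bd[OF ab(1), of x] by (simp only: Rab minus_minus)
    ultimately show ?thesis by (simp only: P_z P_minus eq_diff_eq)
  qed
  have 3: "bd (P (R a p x)) = - ((\<Sum>q\<in>S. P (R c q (R a p x))) + P (R b c (R a p x)) + (\<Sum>q\<in>S. P (R b q (R a p x))))"
    if p: "p \<in> S" for p
  proof -
    have "R a p x \<in> mchains (Suc (Suc k)) (insert b (insert c S))"
      by (rule mchains_mono[OF contr_mchains[OF x(1) TV]]) auto
    then have "P (bd (R a p x)) = bd (P (R a p x)) + (\<Sum>q\<in>S. P (R c q (R a p x))) + P (R b c (R a p x))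
        + (\<Sum>q\<in>S. P (R b q (R a p x)))"
      unfolding P_def by (rule proj_bd_two) (use TV V dist in auto)
    moreover have "bd (R a p x) = - R a p (bd x)"
      by (simp only: contr_bd[OF legs(1)[of a p, OF _ p]] insertI1 minus_minus)
    then have "P (bd (R a p x)) = 0" using leg0[of a p] p by (simp add: P_def)
    ultimately show ?thesis by (simp only: add.assoc eq_neg_iff_add_eq_0)
  qed
  have 4: "bd (P (R c p x)) = - ((\<Sum>q\<in>S. P (R b q (R c p x))) + P (R a b (R c p x)) + (\<Sum>q\<in>S. P (R a q (R c p x))))"
    if p: "p \<in> S" for p
  proof -
    have "R c p x \<in> mchains (Suc (Suc k)) (insert a (insert b S))"
      by (rule mchains_mono[OF contr_mchains[OF x(1) TV]]) auto
    then have "P (bd (R c p x)) = bd (P (R c p x)) + (\<Sum>q\<in>S. P (R b q (R c p x))) + P (R a b (R c p x))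
        + (\<Sum>q\<in>S. P (R a q (R c p x)))"
      unfolding P_def by (rule proj_bd_two) (use TV V dist in auto)
    moreover have "bd (R c p x) = - R c p (bd x)"
      using contr_bd[OF legs(1)[of c p], of x] p by simp
    then have "P (bd (R c p x)) = 0" using leg0[of c p] p by (simp add: P_def)
    ultimately show ?thesis by (simp only: add.assoc eq_neg_iff_add_eq_0)
  qed
  \<comment> \<open>The weights 1 of \<open>a\<close> and -1 of \<open>c\<close>; the parts belonging to \<open>b\<close> have weight 0.\<close>
  define X where "X = P (R b c x) + (\<Sum>p\<in>S. P (R a p x)) - P (R a b x) - (\<Sum>p\<in>S. P (R c p x))"
  define N1 where "N1 = (\<Sum>p\<in>S. \<Sum>q\<in>S. P (R b q (R a p x)))"
  define N2 where "N2 = (\<Sum>p\<in>S. \<Sum>q\<in>S. P (R c q (R a p x)))"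
  define N3 where "N3 = (\<Sum>p\<in>S. \<Sum>q\<in>S. P (R b q (R c p x)))"
  define M1 where "M1 = (\<Sum>p\<in>S. P (R a p (R b c x)))"
  define M2 where "M2 = (\<Sum>p\<in>S. P (R c p (R a b x)))"
  have swap: "R u p (R v q y) = - R v q (R u p y)" if "{u, p} \<in> pairs V" "{v, q} \<in> pairs V" for u p v q y
    using contr_contr[OF that] .
  have M1': "(\<Sum>p\<in>S. P (R b c (R a p x))) = - M1"
    unfolding M1_def sum_negf[symmetric]
  proof (rule sum.cong)
    fix p assume "p \<in> S"
    then show "P (R b c (R a p x)) = - P (R a p (R b c x))"
      using swap[OF ab(2) legs(1)[of a p], of x] by (simp add: P_minus)
  qed simp
  have M2': "(\<Sum>p\<in>S. P (R a b (R c p x))) = - M2"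
    unfolding M2_def sum_negf[symmetric]
  proof (rule sum.cong)
    fix p assume "p \<in> S"
    then show "P (R a b (R c p x)) = - P (R c p (R a b x))"
      using swap[OF ab(1) legs(1)[of c p], of x] by (simp add: P_minus)
  qed simp
  have N2': "(\<Sum>p\<in>S. \<Sum>q\<in>S. P (R a q (R c p x))) = - N2"
  proof -
    have "(\<Sum>p\<in>S. \<Sum>q\<in>S. P (R a q (R c p x))) = (\<Sum>q\<in>S. \<Sum>p\<in>S. P (R a q (R c p x)))"
      by (rule sum.swap)
    also have "\<dots> = (\<Sum>q\<in>S. \<Sum>p\<in>S. - P (R c p (R a q x)))"
    proof (intro sum.cong refl)
      fix p q assume "p \<in> S" "q \<in> S"
      then show "P (R a q (R c p x)) = - P (R c p (R a q x))"
        using swap[OF legs(1)[of a q] legs(1)[of c p], of x] by (simp add: P_minus)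
    qed
    also have "\<dots> = - N2" by (simp only: N2_def sum_negf)
    finally show ?thesis .
  qed
  have A: "bd (\<Sum>p\<in>S. P (R a p x)) = - (N2 + - M1 + N1)"
  proof -
    have "bd (\<Sum>p\<in>S. P (R a p x)) = (\<Sum>p\<in>S. - ((\<Sum>q\<in>S. P (R c q (R a p x))) + P (R b c (R a p x)) + (\<Sum>q\<in>S. P (R b q (R a p x)))))"
      unfolding bd_sum by (rule sum.cong[OF refl 3])
    then show ?thesis by (simp only: sum_negf sum.distrib M1' N2_def N1_def)
  qed
  have C: "bd (\<Sum>p\<in>S. P (R c p x)) = - (N3 + - M2 + - N2)"
  proof -
    have "bd (\<Sum>p\<in>S. P (R c p x)) = (\<Sum>p\<in>S. - ((\<Sum>q\<in>S. P (R b q (R c p x))) + P (R a b (R c p x)) + (\<Sum>q\<in>S. P (R a q (R c p x)))))"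
      unfolding bd_sum by (rule sum.cong[OF refl 4])
    then show ?thesis by (simp only: sum_negf sum.distrib M2' N3_def N2')
  qed
  have "bd X = (z - M1) + - (N2 + - M1 + N1) - (- z - M2) - - (N3 + - M2 + - N2)"
    by (simp only: X_def bd_add bd_diff 1 2 A C M1_def[symmetric] M2_def[symmetric])
  also have "\<dots> = (z + z) - N1 - (N2 + N2) + N3" by (simp add: algebra_simps)
  also have "\<dots> = - z - N1 + N2 + N3" by (simp only: two_eq_neg diff_minus_eq_add)
  finally have bdX: "bd X = - z - N1 + N2 + N3" .
  have PX: "P (contr e x) \<in> mchains (Suc (Suc k)) S" for e
    unfolding P_def by (rule proj_mchains[OF contr_mchains[OF x(1) TV]]) auto
  have X: "X \<in> mchains (Suc (Suc k)) S"
    unfolding X_def by (intro mchains_diff mchains_add mchains_sum PX)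
  have z_N: "homologous (Suc k) S z (- N1 + N2 + N3)"
    by (rule homologousI[of "- X"]) (use X mchains_uminus in \<open>auto simp: bd_minus bdX\<close>)
  \<comment> \<open>Each double sum becomes a triple sum over the same cycles \<open>Y p q s\<close>.\<close>
  let ?h = "homologous (Suc k) S"
  let ?sum = "\<lambda>f :: 'v \<Rightarrow> 'v \<Rightarrow> 'v \<Rightarrow> 'v set set \<Rightarrow> F3. \<Sum>p\<in>S. \<Sum>q\<in>S. \<Sum>s\<in>S. f p q s"
  have N1: "?h N1 (- ?sum (\<lambda>p q s. W p q (Y p q s)))"
    unfolding N1_def sum_negf[symmetric] P_def Y_def
  proof (intro homologous_sum)
    fix p q assume pq: "p \<in> S" "q \<in> S"
    show "?h (proj S (R b q (R a p x))) (\<Sum>s\<in>S. - W p q (proj S (R c s (R b q (R a p x)))))"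
      unfolding sum_negf
      by (rule two_legs[OF S _ _ _ _ x(1) pq]) (use V dist leg0[of a p] pq in auto)
  qed
  have N2: "?h N2 (?sum (\<lambda>p q s. W p s (Y p q s)))"
  proof -
    have "?h N2 (\<Sum>p\<in>S. \<Sum>s\<in>S. \<Sum>q\<in>S. W p s (Y p q s))"
      unfolding N2_def
    proof (intro homologous_sum)
      fix p s assume ps: "p \<in> S" "s \<in> S"
      have T: "insert a (insert b (insert c S)) = insert a (insert c (insert b S))" by auto
      have "?h (proj S (R c s (R a p x))) (- (\<Sum>q\<in>S. W p s (proj S (R b q (R c s (R a p x))))))"
        by (rule two_legs[OF S _ _ _ _ x(1)[unfolded T] ps]) (use V dist leg0[of a p] ps in auto)
      also have "- (\<Sum>q\<in>S. W p s (proj S (R b q (R c s (R a p x))))) = (\<Sum>q\<in>S. W p s (Y p q s))"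
        unfolding sum_negf[symmetric]
      proof (rule sum.cong)
        fix q assume q: "q \<in> S"
        have "R b q (R c s (R a p x)) = - R c s (R b q (R a p x))"
          using q ps by (intro swap legs) auto
        then show "- W p s (proj S (R b q (R c s (R a p x)))) = W p s (Y p q s)"
          by (simp only: Y_def P_def proj_minus wedge_minus minus_minus)
      qed simp
      finally show "?h (P (R c s (R a p x))) (\<Sum>q\<in>S. W p s (Y p q s))" by (simp only: P_def)
    qed
    also have "(\<Sum>p\<in>S. \<Sum>s\<in>S. \<Sum>q\<in>S. W p s (Y p q s)) = ?sum (\<lambda>p q s. W p s (Y p q s))"
      by (rule sum.cong[OF refl], rule sum.swap)
    finally show ?thesis .
  qed
  have N3: "?h N3 (?sum (\<lambda>p q s. W q s (Y p q s)))"
  proof -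
    have "?h N3 (\<Sum>s\<in>S. \<Sum>q\<in>S. \<Sum>p\<in>S. W q s (Y p q s))"
      unfolding N3_def
    proof (intro homologous_sum)
      fix s q assume sq: "s \<in> S" "q \<in> S"
      have T: "insert a (insert b (insert c S)) = insert c (insert b (insert a S))" by auto
      have "?h (proj S (R b q (R c s x))) (- (\<Sum>p\<in>S. W s q (proj S (R a p (R b q (R c s x))))))"
        by (rule two_legs[OF S _ _ _ _ x(1)[unfolded T] sq]) (use V dist leg0[of c s] sq in auto)
      also have "- (\<Sum>p\<in>S. W s q (proj S (R a p (R b q (R c s x))))) = (\<Sum>p\<in>S. W q s (Y p q s))"
        unfolding sum_negf[symmetric]
      proof (rule sum.cong)
        fix p assume p: "p \<in> S"
        have "R a p (R b q (R c s x)) = - R b q (R a p (R c s x))"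
          using p sq by (intro swap legs) auto
        moreover have "R a p (R c s x) = - R c s (R a p x)"
          using p sq by (intro swap legs) auto
        moreover have "R b q (R c s (R a p x)) = - R c s (R b q (R a p x))"
          using p sq by (intro swap legs) auto
        ultimately have "R a p (R b q (R c s x)) = - R c s (R b q (R a p x))"
          by (simp only: contr_minus minus_minus)
        then show "- W s q (proj S (R a p (R b q (R c s x)))) = W q s (Y p q s)"
          by (simp only: Y_def P_def proj_minus wedge_minus minus_minus insert_commute[of s q])
      qed simp
      finally show "?h (P (R b q (R c s x))) (\<Sum>p\<in>S. W q s (Y p q s))" by (simp only: P_def)
    qed
    also have "(\<Sum>s\<in>S. \<Sum>q\<in>S. \<Sum>p\<in>S. W q s (Y p q s)) = (\<Sum>s\<in>S. \<Sum>p\<in>S. \<Sum>q\<in>S. W q s (Y p q s))"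
      by (rule sum.cong[OF refl], rule sum.swap)
    also have "\<dots> = (\<Sum>p\<in>S. \<Sum>s\<in>S. \<Sum>q\<in>S. W q s (Y p q s))"
      by (rule sum.swap)
    also have "\<dots> = ?sum (\<lambda>p q s. W q s (Y p q s))"
      by (rule sum.cong[OF refl], rule sum.swap)
    finally show ?thesis .
  qed
  have "?h (- N1 + N2 + N3) (- (- ?sum (\<lambda>p q s. W p q (Y p q s))) + ?sum (\<lambda>p q s. W p s (Y p q s))
      + ?sum (\<lambda>p q s. W q s (Y p q s)))"
    by (intro homologous_add homologous_uminus N1 N2 N3)
  also have "- (- ?sum (\<lambda>p q s. W p q (Y p q s))) + ?sum (\<lambda>p q s. W p s (Y p q s))
      + ?sum (\<lambda>p q s. W q s (Y p q s)) = ?sum (\<lambda>p q s. tri p q s (Y p q s))"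
    by (simp only: tri_def sum.distrib minus_minus ac_simps)
  finally have "?h z (?sum (\<lambda>p q s. tri p q s (Y p q s)))"
    using homologous_trans[OF z_N] by blast
  moreover have "Y p q s \<in> mcycles k (S - {p, q, s})"
    if pqs: "p \<in> S" "q \<in> S" "s \<in> S" "distinct [p, q, s]" for p q s
  proof -
    define y where "y = R c s (R b q (R a p x))"
    have "R b q (R a p x) \<in> mchains (Suc k) (?T - {a, p} - {b, q})"
      by (rule contr_mchains[OF contr_mchains[OF x(1) TV]]) (use TV in auto)
    then have "y \<in> mchains k (?T - {a, p} - {b, q} - {c, s})"
      unfolding y_def by (rule contr_mchains) (use TV in auto)
    then have y: "y \<in> mchains k (S - {p, q, s})" by (rule mchains_mono) auto
    have e: "{c, s} \<in> pairs V" "{b, q} \<in> pairs V" "{a, p} \<in> pairs V" using pqs legs(1) by auto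
    have "bd y = - R c s (R b q (R a p (bd x)))"
      by (simp only: y_def contr_bd[OF e(1)] contr_bd[OF e(2)] contr_bd[OF e(3)] contr_minus minus_minus)
    then have "bd y = 0" using leg0[of a p] pqs by simp
    moreover have "Y p q s = y"
      unfolding Y_def P_def y_def[symmetric] using mchains_mono[OF y, of S] by (intro proj_id) auto
    ultimately show ?thesis using y by (simp add: mcycles_def)
  qed
  moreover have "Y p q s = 0" if pqs: "p \<in> S" "q \<in> S" "s \<in> S" "\<not> distinct [p, q, s]" for p q s
  proof -
    have xa: "R a p x \<in> mchains (Suc (Suc k)) (?T - {a, p})"
      by (rule contr_mchains[OF x(1) TV])
    have xab: "R b q (R a p x) \<in> mchains (Suc k) (?T - {a, p} - {b, q})"
      by (rule contr_mchains[OF xa]) (use TV in auto)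
    have "R c s (R b q (R a p x)) = 0"
    proof (cases "p = q")
      case True
      have "R b q (R a p x) = 0" by (rule contr_mchains_outside[OF xa]) (use True in \<open>auto simp: pairs_eq\<close>)
      then show ?thesis by (simp only: contr_zero)
    next
      case False
      then have "s = p \<or> s = q" using pqs by auto
      then show ?thesis by (intro contr_mchains_outside[OF xab]) (auto simp: pairs_eq)
    qed
    then show ?thesis by (simp only: Y_def P_def proj_zero)
  qed
  ultimately show ?thesis using that by blast
qed

end

section \<open>Products of paths do not bound\<close>

context ordered_matchings
begin

text \<open>Nonbounding even modulo products of triangles with cycles, which is the hypothesis under which the
inductive step can be applied. It is meant for \<open>k \<ge> 1\<close>; the number \<open>k - 1\<close> counts the edges of the
second factor of such a product.\<close>

definition essential :: "nat \<Rightarrow> 'v set \<Rightarrow> ('v set set \<Rightarrow> F3) \<Rightarrow> bool" where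
  "essential k S z \<longleftrightarrow> \<not> (\<exists>Y.
     (\<forall>p\<in>S. \<forall>q\<in>S. \<forall>s\<in>S. if distinct [p, q, s] then Y p q s \<in> mcycles (k - 1) (S - {p, q, s})
       else Y p q s = 0) \<and>
     homologous k S z (\<Sum>p\<in>S. \<Sum>q\<in>S. \<Sum>s\<in>S. tri p q s (Y p q s)))"

lemma tri_zero [simp]: "tri p q s 0 = 0"
  by (simp add: tri_def)

lemma path_zero [simp]: "path p q s 0 = 0"
  by (simp add: path_def)

lemma essential_not_bound: "essential k S z \<Longrightarrow> z \<notin> mbounds k S"
proof
  assume e: "essential k S z" and z: "z \<in> mbounds k S"
  from e show False
    unfolding essential_def
  proof (rule notE, intro exI[of _ "\<lambda>p q s. 0"] conjI)
    show "\<forall>p\<in>S. \<forall>q\<in>S. \<forall>s\<in>S. if distinct [p, q, s] then 0 \<in> mcycles (k - 1) (S - {p, q, s})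
       else (0 :: 'v set set \<Rightarrow> F3) = 0"
      by (intro ballI) (simp del: distinct.simps)
    show "homologous k S z (\<Sum>p\<in>S. \<Sum>q\<in>S. \<Sum>s\<in>S. tri p q s 0)"
      using z by (simp only: homologous_def tri_zero sum.neutral_const diff_zero)
  qed
qed

lemma essential_path_not_bound:
  assumes S: "S \<subseteq> V" and V: "{a, b, c} \<subseteq> V - S" and dist: "a \<noteq> b" "b \<noteq> c" "a \<noteq> c"
    and z: "z \<in> mcycles (Suc k) S" and e: "essential (Suc k) S z"
  shows "path a b c z \<notin> mbounds (Suc (Suc k)) (insert a (insert b (insert c S)))"
proof
  assume "path a b c z \<in> mbounds (Suc (Suc k)) (insert a (insert b (insert c S)))"
  from path_bound_step[OF S V dist z this] obtain Y where Y:
    "\<And>p q s. p \<in> S \<Longrightarrow> q \<in> S \<Longrightarrow> s \<in> S \<Longrightarrow> distinct [p, q, s] \<Longrightarrow> Y p q s \<in> mcycles k (S - {p, q, s})"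
    "\<And>p q s. p \<in> S \<Longrightarrow> q \<in> S \<Longrightarrow> s \<in> S \<Longrightarrow> \<not> distinct [p, q, s] \<Longrightarrow> Y p q s = 0"
    "homologous (Suc k) S z (\<Sum>p\<in>S. \<Sum>q\<in>S. \<Sum>s\<in>S. tri p q s (Y p q s))"
    by blast
  have "\<forall>p\<in>S. \<forall>q\<in>S. \<forall>s\<in>S. if distinct [p, q, s] then Y p q s \<in> mcycles (Suc k - 1) (S - {p, q, s})
       else Y p q s = 0"
    using Y(1,2) by (auto simp del: distinct.simps)
  then show False using e Y(3) unfolding essential_def by blast
qed

text \<open>With at least two edges all products of a triangle with a cycle bound, so nothing is gained by
working modulo them.\<close>

lemma not_bound_essential:
  assumes S: "S \<subseteq> V" "card S = 3 * Suc (Suc k) + 1" and z: "z \<notin> mbounds (Suc (Suc k)) S"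
  shows "essential (Suc (Suc k)) S z"
  unfolding essential_def
proof
  assume "\<exists>Y. (\<forall>p\<in>S. \<forall>q\<in>S. \<forall>s\<in>S. if distinct [p, q, s]
      then Y p q s \<in> mcycles (Suc (Suc k) - 1) (S - {p, q, s}) else Y p q s = 0) \<and>
     homologous (Suc (Suc k)) S z (\<Sum>p\<in>S. \<Sum>q\<in>S. \<Sum>s\<in>S. tri p q s (Y p q s))"
  then obtain Y where Y: "\<And>p q s. p \<in> S \<Longrightarrow> q \<in> S \<Longrightarrow> s \<in> S \<Longrightarrow> if distinct [p, q, s]
      then Y p q s \<in> mcycles (Suc (Suc k) - 1) (S - {p, q, s}) else Y p q s = 0"
     "homologous (Suc (Suc k)) S z (\<Sum>p\<in>S. \<Sum>q\<in>S. \<Sum>s\<in>S. tri p q s (Y p q s))" by blast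
  have "tri p q s (Y p q s) \<in> mbounds (Suc (Suc k)) S" if "p \<in> S" "q \<in> S" "s \<in> S" for p q s
  proof (cases "distinct [p, q, s]")
    case True
    have fin: "finite S" using finite_subset[OF S(1) finite_V] .
    let ?T = "S - {p, q, s}"
    have "Y p q s \<in> mcycles (Suc k) ?T" using Y(1)[OF that] True by simp
    moreover have "card ?T = 3 * Suc k + 1"
      using True that S(2) by (subst card_Diff_subset) auto
    ultimately have "tri p q s (Y p q s) \<in> mbounds (Suc (Suc k)) (insert p (insert q (insert s ?T)))"
      by (intro tri_mcycles_bound) (use S that True in auto)
    moreover have "insert p (insert q (insert s ?T)) = S" using that by auto
    ultimately show ?thesis by simp
  next
    case False
    then have "Y p q s = 0" using Y(1)[OF that] by (simp del: distinct.simps)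
    then show ?thesis by (simp only: tri_zero mbounds_zero)
  qed
  then have "(\<Sum>p\<in>S. \<Sum>q\<in>S. \<Sum>s\<in>S. tri p q s (Y p q s)) \<in> mbounds (Suc (Suc k)) S"
    by (intro mbounds_sum)
  from mbounds_add[OF Y(2)[unfolded homologous_def] this] show False
    using z by (simp only: diff_add_cancel)
qed

definition empty_chain :: "'v set set \<Rightarrow> 'k::comm_ring_1" where
  "empty_chain = (\<lambda>\<sigma>. if \<sigma> = {} then 1 else 0)"

lemma empty_chain_mchains: "empty_chain \<in> mchains 0 S"
  by (auto simp: empty_chain_def mchains_def matchings_of_size_def)

lemma bd_empty_chain: "bd empty_chain = 0"
  using empty_chain_mchains[of "{}"] by (rule bd_mchains_0) simp

lemma wedge_singleton: "wedge e c {f} = (if e = f then c {} else 0)"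
  for c :: "'v set set \<Rightarrow> 'k::comm_ring_1"
proof -
  have "osgn g {} = (1 :: 'k)" for g by (simp add: osgn_def)
  then show ?thesis by (simp add: wedge_def)
qed

text \<open>The matching complex on four vertices consists of three disjoint segments, each joining two
complementary edges.\<close>

lemma bd_complementary_edges:
  fixes X :: "'v set set \<Rightarrow> 'k::comm_ring_1"
  assumes X: "X \<in> mchains 2 S" and S: "S = {x, y, u, w}" "distinct [x, y, u, w]" "S \<subseteq> V"
  shows "bd X {{x, y}} + bd X {{u, w}} = 0"
proof -
  have main: "bd X {e} = osgn f {e} * X {f, e}"
    if ef: "e \<in> pairs S" "f \<in> pairs S" "e \<inter> f = {}" "e \<union> f = S" for e f
  proof -
    have e: "e \<noteq> {}" "f \<noteq> {}" "e \<noteq> f" using ef(1-3) by (auto simp: pairs_def)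
    have V: "f \<in> pairs V" using ef pairs_mono S by blast
    have "bd X {e} = (\<Sum>g\<in>pairs V. contr g X {e})"
      by (simp add: bd_def sum_fun_apply)
    also have "\<dots> = (\<Sum>g\<in>pairs V. if g = f then contr f X {e} else 0)"
    proof (rule sum.cong)
      fix g assume "g \<in> pairs V"
      show "contr g X {e} = (if g = f then contr f X {e} else 0)"
      proof (cases "g = f")
        case False
        have "{g, e} \<notin> matchings_of_size 2 S" if "g \<noteq> e"
        proof
          assume "{g, e} \<in> matchings_of_size 2 S"
          then have g: "g \<in> pairs S" "disjnt g e"
            using that by (auto simp: matchings_of_size_def pairwise_insert)
          then have "g \<subseteq> f" using ef pairs_subset[of g S] by (auto simp: disjnt_def)
          moreover have "card g = 2" "card f = 2" using g ef by (auto simp: pairs_eq)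
          ultimately show False using False card_subset_eq[of f g] by (metis card.infinite zero_neq_numeral)
        qed
        then have "g \<noteq> e \<Longrightarrow> X {g, e} = 0" using X by (auto simp: mchains_def)
        then show ?thesis using False by (simp add: contr_def)
      qed simp
    qed simp
    also have "\<dots> = contr f X {e}" using V finite_E by simp
    also have "\<dots> = osgn f {e} * X {f, e}" using e by (simp add: contr_def)
    finally show ?thesis .
  qed
  let ?e = "{x, y}" and ?f = "{u, w}"
  have p: "?e \<in> pairs S" "?f \<in> pairs S" "?e \<inter> ?f = {}" "?e \<union> ?f = S" "?e \<noteq> ?f"
    using S by (auto intro!: pairsI)
  have V: "?e \<in> pairs V" "?f \<in> pairs V" using p pairs_mono S(3) by blast+
  have one: "osgn g {} = (1 :: 'k)" for g by (simp add: osgn_def)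
  have "osgn g {h} = (if (h, g) \<in> r then - 1 else (1 :: 'k))" if "h \<in> pairs V" "g \<noteq> h" for g h
    using that by (simp add: osgn_insert one)
  then have "osgn ?f {?e} = - (osgn ?e {?f} :: 'k)"
    using order_cases[OF V p(5)] V p(5) by (metis minus_minus)
  moreover have "bd X {?e} = osgn ?f {?e} * X {?f, ?e}" by (rule main) (use p in auto)
  moreover have "bd X {?f} = osgn ?e {?f} * X {?e, ?f}" by (rule main) (use p in auto)
  ultimately show ?thesis by (simp add: insert_commute)
qed

text \<open>The base case, on four vertices. The functional \<open>\<phi>\<close> takes the values 0, 1, -1 on the three components
of the matching complex. Every triangle meets each component once, hence \<open>\<phi>\<close> kills triangles, but
it separates the two edges of the path.\<close>

lemma single_path_essential:
  assumes S: "S = {a, b, c, v}" and dist: "distinct [a, b, c, v]" and V: "S \<subseteq> V"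
  shows "essential (Suc 0) S (path a b c empty_chain)"
  unfolding essential_def
proof
  define \<phi> :: "('v set set \<Rightarrow> F3) \<Rightarrow> F3" where
    "\<phi> x = x {{b, c}} + x {{a, v}} - x {{a, c}} - x {{b, v}}" for x
  have \<phi>_add: "\<phi> (x + y) = \<phi> x + \<phi> y" for x y by (simp add: \<phi>_def)
  have \<phi>_0: "\<phi> 0 = 0" by (simp add: \<phi>_def)
  have \<phi>_sum: "\<phi> (\<Sum>i\<in>A. x i) = (\<Sum>i\<in>A. \<phi> (x i))" for A :: "'v set" and x
    by (induction A rule: infinite_finite_induct)
       (simp_all only: sum.infinite sum.empty sum.insert \<phi>_0 \<phi>_add if_True not_False_eq_True)
  have \<phi>_bd: "\<phi> (bd X) = 0" if X: "X \<in> mchains 2 S" for X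
  proof -
    have 0: "bd X {{b, c}} + bd X {{a, v}} = 0" "bd X {{a, c}} + bd X {{b, v}} = 0"
      using S dist V by (intro bd_complementary_edges[OF X]; auto)+
    show ?thesis by (simp only: \<phi>_def diff_diff_eq 0 diff_self)
  qed
  have \<phi>_tri: "\<phi> (tri p q s y) = 0" if "p \<in> S" "q \<in> S" "s \<in> S" "distinct [p, q, s]" for p q s y
    using that dist unfolding S \<phi>_def tri_def
    by (auto simp: wedge_singleton doubleton_eq_iff)
  assume "\<exists>Y. (\<forall>p\<in>S. \<forall>q\<in>S. \<forall>s\<in>S. if distinct [p, q, s]
      then Y p q s \<in> mcycles (Suc 0 - 1) (S - {p, q, s}) else Y p q s = 0) \<and>
     homologous (Suc 0) S (path a b c empty_chain) (\<Sum>p\<in>S. \<Sum>q\<in>S. \<Sum>s\<in>S. tri p q s (Y p q s))"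
  then obtain Y where Y: "\<And>p q s. p \<in> S \<Longrightarrow> q \<in> S \<Longrightarrow> s \<in> S \<Longrightarrow> if distinct [p, q, s]
      then Y p q s \<in> mcycles (Suc 0 - 1) (S - {p, q, s}) else Y p q s = 0"
     "homologous (Suc 0) S (path a b c empty_chain) (\<Sum>p\<in>S. \<Sum>q\<in>S. \<Sum>s\<in>S. tri p q s (Y p q s))" by blast
  obtain X where X: "X \<in> mchains 2 S"
    "path a b c empty_chain = (\<Sum>p\<in>S. \<Sum>q\<in>S. \<Sum>s\<in>S. tri p q s (Y p q s)) + bd X"
    using Y(2) by (auto elim: homologousE simp: numeral_2_eq_2)
  have "\<phi> (tri p q s (Y p q s)) = 0" if "p \<in> S" "q \<in> S" "s \<in> S" for p q s
    using \<phi>_tri[OF that] Y(1)[OF that] by (cases "distinct [p, q, s]") (simp_all add: \<phi>_0 del: distinct.simps)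
  then have "\<phi> (path a b c empty_chain) = 0"
    unfolding X(2) \<phi>_add \<phi>_sum using \<phi>_bd[OF X(1)] by simp
  moreover have "\<phi> (path a b c empty_chain) = - 1"
    using dist unfolding \<phi>_def path_def by (auto simp: wedge_singleton doubleton_eq_iff empty_chain_def)
  ultimately show False by simp
qed

definition paths :: "('v \<times> 'v \<times> 'v) list \<Rightarrow> 'v set set \<Rightarrow> 'k::comm_ring_1" where
  "paths ts = foldr (\<lambda>(a, b, c). path a b c) ts empty_chain"

lemma paths_Nil [simp]: "paths [] = empty_chain"
  and paths_Cons [simp]: "paths ((a, b, c) # ts) = path a b c (paths ts)"
  by (simp_all add: paths_def)

end

definition path_points :: "('v \<times> 'v \<times> 'v) list \<Rightarrow> 'v list" where
  "path_points ts = concat (map (\<lambda>(a, b, c). [a, b, c]) ts)"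

lemma path_points_Nil [simp]: "path_points [] = []"
  and path_points_Cons [simp]: "path_points ((a, b, c) # ts) = a # b # c # path_points ts"
  by (simp_all add: path_points_def)

context ordered_matchings
begin

lemma paths_mchains:
  assumes "distinct (path_points ts)" "set (path_points ts) \<subseteq> V"
  shows "paths ts \<in> mchains (length ts) (set (path_points ts))"
  using assms
proof (induction ts)
  case (Cons t ts)
  obtain a b c where t: "t = (a, b, c)" by (cases t)
  show ?case unfolding t
    by (simp, rule path_mchains[OF Cons.IH]) (use Cons.prems in \<open>auto simp: t\<close>)
qed (simp add: empty_chain_mchains)

lemma bd_paths:
  assumes "distinct (path_points ts)" "set (path_points ts) \<subseteq> V"
  shows "bd (paths ts) = (0 :: 'v set set \<Rightarrow> 'k::comm_ring_1)"
  using assms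
proof (induction ts)
  case (Cons t ts)
  obtain a b c where t: "t = (a, b, c)" by (cases t)
  have "bd (paths ts) = (0 :: 'v set set \<Rightarrow> 'k)" using Cons by (auto simp: t)
  moreover have "bd (path a b c (paths ts)) = - path a b c (bd (paths ts) :: 'v set set \<Rightarrow> 'k)"
    using Cons.prems by (intro bd_path) (auto simp: t)
  ultimately show ?case by (simp add: t)
qed (simp add: bd_empty_chain)

lemma paths_mcycles:
  assumes "distinct (path_points ts)" "set (path_points ts) \<subseteq> S" "S \<subseteq> V"
  shows "paths ts \<in> mcycles (length ts) S"
  using assms mchains_mono[OF paths_mchains, of ts S] bd_paths[of ts] by (auto simp: mcycles_def)

text \<open>Each path multiplies a class on \<open>3 k + 1\<close> vertices to one on \<open>3 k + 4\<close> vertices, and it stays essential.\<close>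

theorem paths_essential:
  assumes "ts \<noteq> []" "distinct (path_points ts)" "set (path_points ts) \<subseteq> S" "S \<subseteq> V"
    "card S = 3 * length ts + 1"
  shows "essential (length ts) S (paths ts)"
  using assms
proof (induction ts arbitrary: S rule: list_nonempty_induct)
  case (single t S)
  obtain a b c where t: "t = (a, b, c)" by (cases t)
  have "finite S" using single.prems finite_subset[OF _ finite_V] by blast
  then have "card (S - {a, b, c}) = 1"
    using single.prems by (subst card_Diff_subset) (auto simp: t)
  then obtain v where "S - {a, b, c} = {v}" by (auto simp: card_1_singleton_iff)
  then have "S = {a, b, c, v}" "distinct [a, b, c, v]" using single.prems by (auto simp: t)
  from single_path_essential[OF this single.prems(3)] show ?case by (simp add: t)
next
  case (cons t ts S)
  obtain a b c where t: "t = (a, b, c)" by (cases t)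
  define S' where "S' = S - {a, b, c}"
  have S: "S = insert a (insert b (insert c S'))" "{a, b, c} \<subseteq> V - S'" "S' \<subseteq> V"
    using cons.prems by (auto simp: S'_def t)
  have pts: "distinct (path_points ts)" "set (path_points ts) \<subseteq> S'"
    using cons.prems by (auto simp: t S'_def)
  have "finite S" using cons.prems finite_subset[OF _ finite_V] by blast
  then have card: "card S' = 3 * length ts + 1"
    using cons.prems unfolding S'_def by (subst card_Diff_subset) (auto simp: t)
  obtain k where k: "length ts = Suc k" using cons.hyps by (cases ts) auto
  have "path a b c (paths ts) \<notin> mbounds (Suc (Suc k)) (insert a (insert b (insert c S')))"
  proof (rule essential_path_not_bound[OF S(3,2)])
    show "paths ts \<in> mcycles (Suc k) S'" using paths_mcycles[OF pts S(3)] k by simp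
    show "essential (Suc k) S' (paths ts)" using cons.IH[OF pts S(3) card] k by simp
  qed (use cons.prems in \<open>auto simp: t\<close>)
  then have "path a b c (paths ts) \<notin> mbounds (Suc (Suc k)) S" by (simp only: S(1)[symmetric] not_False_eq_True)
  from not_bound_essential[OF cons.prems(3) _ this] show ?case
    using cons.prems k by (simp add: t)
qed

text \<open>Multiplication by the 1-cycle \<open>ab, cd, be, ad, bc, de\<close> of length six. All its edges join \<open>{b, d}\<close> to
\<open>{a, c, e}\<close>, so it lies in the chessboard complex of a 2 by 3 board.\<close>

definition hexagon :: "'v \<Rightarrow> 'v \<Rightarrow> 'v \<Rightarrow> 'v \<Rightarrow> 'v \<Rightarrow> ('v set set \<Rightarrow> 'k::comm_ring_1) \<Rightarrow> 'v set set \<Rightarrow> 'k" where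
  "hexagon a b c d e z = W a b (W c d z) + W c d (W b e z) + W b e (W a d z)
     + W a d (W b c z) + W b c (W d e z) + W d e (W a b z)"

lemma bd_hexagon:
  assumes "{a, b, c, d, e} \<subseteq> V" "distinct [a, b, c, d, e]" "bd z = 0"
  shows "bd (hexagon a b c d e z) = 0"
proof -
  have "{a, b} \<in> pairs V" "{c, d} \<in> pairs V" "{b, e} \<in> pairs V" "{a, d} \<in> pairs V"
    "{b, c} \<in> pairs V" "{d, e} \<in> pairs V"
    using assms by (auto intro!: pairsI)
  then show ?thesis
    using assms(3) by (simp add: hexagon_def bd_add bd_wedge wedge_diff)
qed

lemma hexagon_mchains:
  assumes z: "z \<in> mchains j S" and "{a, b, c, d, e} \<subseteq> T - S" "distinct [a, b, c, d, e]" "S \<subseteq> T" "T \<subseteq> V"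
  shows "hexagon a b c d e z \<in> mchains (Suc (Suc j)) T"
proof -
  have "W x y (W u v z) \<in> mchains (Suc (Suc j)) T"
    if "{x, y, u, v} \<subseteq> {a, b, c, d, e}" "distinct [x, y, u, v]" for x y u v
  proof -
    have "W u v z \<in> mchains (Suc j) (T - {x, y})"
      by (rule W_mchains[OF z]) (use assms that in auto)
    then show ?thesis by (rule W_mchains) (use assms that in auto)
  qed
  then show ?thesis unfolding hexagon_def using assms(3) by (intro mchains_add) auto
qed

text \<open>Contracting the edge \<open>{a, b}\<close> leaves the path \<open>c\<close>-\<open>d\<close>-\<open>e\<close> formed by its two neighbours in the
hexagon. A filling would thus give a filling of a product of paths on the remaining \<open>3 k + 1\<close> vertices,
where \<open>k = length ts + 1\<close>.\<close>

lemma hexagon_not_bound: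
  assumes dist: "distinct ([a, b, c, d, e] @ path_points ts)"
    and sub: "{a, b, c, d, e} \<union> set (path_points ts) \<subseteq> V" and card: "card V = 3 * length ts + 6"
  shows "hexagon a b c d e (paths ts) \<notin> mbounds (Suc (Suc (length ts))) V"
proof
  define z :: "'v set set \<Rightarrow> F3" where "z = paths ts"
  assume "hexagon a b c d e (paths ts) \<in> mbounds (Suc (Suc (length ts))) V"
  then obtain B where B: "B \<in> mchains (Suc (Suc (Suc (length ts)))) V" "hexagon a b c d e z = bd B"
    by (auto simp: mbounds_def z_def)
  have zc: "z \<in> mchains (length ts) (set (path_points ts))"
    unfolding z_def using dist sub by (intro paths_mchains) auto
  have e: "{a, b} \<in> pairs V" "{c, d} \<in> pairs V" "{b, e} \<in> pairs V" "{a, d} \<in> pairs V"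
    "{b, c} \<in> pairs V" "{d, e} \<in> pairs V"
    using sub dist by (auto intro!: pairsI)
  have ne: "{a, b} \<noteq> {c, d}" "{a, b} \<noteq> {b, e}" "{a, b} \<noteq> {a, d}" "{a, b} \<noteq> {b, c}" "{a, b} \<noteq> {d, e}"
    using dist by (auto simp: doubleton_eq_iff)
  have 0: "R a b z = 0"
    by (rule contr_mchains_outside[OF zc]) (use dist in \<open>auto simp: pairs_eq\<close>)
  have "R a b (hexagon a b c d e z) = path c d e z"
    unfolding hexagon_def path_def
    using e by (simp add: contr_add contr_wedge[OF e(1) _ ne(1)] contr_wedge[OF e(1) _ ne(2)]
        contr_wedge[OF e(1) _ ne(3)] contr_wedge[OF e(1) _ ne(4)] contr_wedge[OF e(1) _ ne(5)]
        contr_wedge_self 0 wedge_minus)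
  then have "path c d e z = bd (- R a b B)"
    using contr_bd[OF e(1), of B] by (simp add: B(2) bd_minus)
  moreover have "- R a b B \<in> mchains (Suc (Suc (length ts))) (V - {a, b})"
    by (intro mchains_uminus contr_mchains[OF B(1)]) auto
  ultimately have "paths ((c, d, e) # ts) \<in> mbounds (length ((c, d, e) # ts)) (V - {a, b})"
    by (intro mboundsI[of "- R a b B"]) (simp_all add: z_def)
  moreover have "essential (length ((c, d, e) # ts)) (V - {a, b}) (paths ((c, d, e) # ts))"
  proof (rule paths_essential)
    show "card (V - {a, b}) = 3 * length ((c, d, e) # ts) + 1"
      using card sub dist by (subst card_Diff_subset) auto
  qed (use dist sub in auto)
  ultimately show False using essential_not_bound by blast
qed

text \<open>In the top dimension there is nothing to bound, and it is enough that the product of paths does not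
vanish: contracting the first edge of each path recovers the remaining product.\<close>

lemma paths_nonzero:
  assumes "distinct (path_points ts)" "set (path_points ts) \<subseteq> V"
  shows "paths ts \<noteq> (0 :: 'v set set \<Rightarrow> 'k::comm_ring_1)"
  using assms
proof (induction ts)
  case Nil
  have "empty_chain {} \<noteq> (0 :: 'k)" by (simp add: empty_chain_def)
  then show ?case by (auto simp: fun_eq_iff)
next
  case (Cons t ts)
  obtain a b c where t: "t = (a, b, c)" by (cases t)
  define z :: "'v set set \<Rightarrow> 'k" where "z = paths ts"
  have zc: "z \<in> mchains (length ts) (set (path_points ts))"
    unfolding z_def using Cons.prems by (intro paths_mchains) (auto simp: t)
  have e: "{a, b} \<in> pairs V" "{b, c} \<in> pairs V" "{a, b} \<noteq> {b, c}"
    using Cons.prems by (auto intro!: pairsI simp: t doubleton_eq_iff)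
  have "{a, b} \<notin> pairs (set (path_points ts))" using Cons.prems by (auto simp: t pairs_eq)
  then have "R a b (path a b c z) = z"
    unfolding path_def contr_diff using zc e by (simp add: contr_wedge_outside)
  then have "path a b c z \<noteq> 0" using Cons by (auto simp: t z_def)
  then show "paths (t # ts) \<noteq> (0 :: 'v set set \<Rightarrow> 'k)" unfolding t paths_Cons z_def .
qed

end

section \<open>From chains to simplicial homology\<close>

text \<open>The given order compares only the edges of the complex, but the argument takes place among all edges
of a complete graph.\<close>

lemma linear_order_extension:
  assumes r: "linear_order_on A r" and sub: "A \<subseteq> B"
  obtains r' where "linear_order_on B r'" "\<And>x y. x \<in> A \<Longrightarrow> y \<in> A \<Longrightarrow> (x, y) \<in> r' \<longleftrightarrow> (x, y) \<in> r"
proof -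
  obtain s where "well_order_on (B - A) s" using well_order_on by blast
  then have s: "linear_order_on (B - A) s" by (simp add: well_order_on_def)
  define r' where "r' = r \<union> A \<times> (B - A) \<union> s"
  have r_sub: "r \<subseteq> A \<times> A" and s_sub: "s \<subseteq> (B - A) \<times> (B - A)"
    using r s by (auto simp: order_on_defs)
  have "linear_order_on B r'"
    unfolding order_on_defs
  proof (intro conjI)
    show "refl_on B r'" using r s sub by (auto simp: r'_def order_on_defs refl_on_def)
    show "r' \<subseteq> B \<times> B" using r_sub s_sub sub by (auto simp: r'_def)
    have "trans r" "trans s" using r s by (auto simp: order_on_defs)
    then show "trans r'" using r_sub s_sub by (auto simp: r'_def trans_def; blast)
    have "antisym r" "antisym s" using r s by (auto simp: order_on_defs)
    then show "antisym r'" using r_sub s_sub by (auto simp: r'_def antisym_def; blast)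
    have "total_on A r" "total_on (B - A) s" using r s by (auto simp: order_on_defs)
    then show "total_on B r'" using sub by (auto simp: r'_def total_on_def)
  qed
  moreover have "(x, y) \<in> r' \<longleftrightarrow> (x, y) \<in> r" if "x \<in> A" "y \<in> A" for x y
    using that s_sub by (auto simp: r'_def)
  ultimately show ?thesis using that by blast
qed

lemma nontrivial_homologyI:
  assumes K: "simplicial_complex K" and z: "z \<in> simplicial_cycles r K d" "z \<notin> simplicial_boundaries r K d"
  shows "\<not> trivial_group (reduced_homology_group r K d)"
proof
  let ?C = "simplicial_chain_group K d" and ?Z = "simplicial_cycles r K d"
    and ?B = "simplicial_boundaries r K d"
  let ?H = "subgroup_generated ?C ?Z"
  interpret C: comm_group ?C
    by (simp add: simplicial_chain_group_def abelian_free_Abelian_group)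
  have sgZ: "subgroup ?Z ?C" by (rule subgroup_simplicial_cycles)
  have carrier: "carrier ?H = ?Z" using subgroup.carrier_subgroup_generated_subgroup[OF sgZ] .
  have B0: "0 \<in> ?B"
    using subgroup.one_closed[OF subgroup_simplicial_boundaries[OF K]] by (simp add: simplicial_chain_group_def)
  assume "trivial_group (reduced_homology_group r K d)"
  then have "carrier (?H Mod ?B) = {\<one>\<^bsub>?H Mod ?B\<^esub>}"
    by (simp add: trivial_group_def reduced_homology_group_def)
  then have "rcosets\<^bsub>?H\<^esub> ?B = {?B}" by (simp add: FactGroup_def)
  moreover have "?B #>\<^bsub>?H\<^esub> z \<in> rcosets\<^bsub>?H\<^esub> ?B"
    using z(1) carrier by (auto simp: RCOSETS_def)
  ultimately have "?B #>\<^bsub>?H\<^esub> z = ?B" by simp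
  moreover have "z \<in> ?B #>\<^bsub>?H\<^esub> z"
    using B0 by (force simp: r_coset_def simplicial_chain_group_def)
  ultimately show False using z(2) by simp
qed

context ordered_matchings
begin

text \<open>The simplicial boundary is the sum of contractions. Only the order on the edges that occur matters.\<close>

lemma lookup_simplicial_boundary:
  assumes E: "E0 \<subseteq> pairs V" and agree: "\<And>e f. e \<in> E0 \<Longrightarrow> f \<in> E0 \<Longrightarrow> (e, f) \<in> r \<longleftrightarrow> (e, f) \<in> r0"
    and c: "Poly_Mapping.keys c \<subseteq> Pow E0"
  shows "Poly_Mapping.lookup (simplicial_boundary r0 c) = bd (Poly_Mapping.lookup c)"
  using c
proof (induction c rule: frag_induction)
  case zero
  have "Poly_Mapping.lookup (0 :: 'v set set \<Rightarrow>\<^sub>0 int) = 0" by (auto simp: fun_eq_iff)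
  then show ?case by (simp only: simplicial_boundary_def frag_extend_0 bd_zero)
next
  case (one \<sigma>)
  have fin: "finite \<sigma>" using one E finite_subset[OF _ finite_E, of \<sigma>] by auto
  show ?case
  proof
    fix \<tau>
    have "Poly_Mapping.lookup (simplicial_boundary r0 (frag_of \<sigma>)) \<tau> =
        (\<Sum>e\<in>\<sigma>. if \<sigma> - {e} = \<tau> then (- 1) ^ card {u \<in> \<sigma>. (u, e) \<in> r0 - Id} else 0)"
      unfolding simplicial_boundary_of lookup_sum by (rule sum.cong) auto
    also have "\<dots> = (\<Sum>e\<in>\<sigma>. contr e (Poly_Mapping.lookup (frag_of \<sigma>)) \<tau>)"
    proof (rule sum.cong)
      fix e assume e: "e \<in> \<sigma>"
      show "(if \<sigma> - {e} = \<tau> then (- 1) ^ card {u \<in> \<sigma>. (u, e) \<in> r0 - Id} else 0)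
          = contr e (Poly_Mapping.lookup (frag_of \<sigma>)) \<tau>"
      proof (cases "\<sigma> - {e} = \<tau>")
        case True
        have "(u, e) \<in> r \<longleftrightarrow> (u, e) \<in> r0" if "u \<in> \<sigma>" for u
          by (rule agree) (use one e that in auto)
        moreover have "\<sigma> \<subseteq> pairs V" using one E by auto
        ultimately have "{u \<in> \<tau> \<inter> pairs V. (u, e) \<in> r - Id} = {u \<in> \<sigma>. (u, e) \<in> r0 - Id}"
          unfolding True[symmetric] by blast
        moreover have "e \<notin> \<tau>" "insert e \<tau> = \<sigma>" using True e by auto
        ultimately show ?thesis using True by (simp add: contr_def osgn_def)
      next
        case False
        then have "\<not> (e \<notin> \<tau> \<and> insert e \<tau> = \<sigma>)" by auto
        then have "contr e (Poly_Mapping.lookup (frag_of \<sigma>)) \<tau> = 0" by (auto simp: contr_def)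
        then show ?thesis using False by simp
      qed
    qed simp
    also have "\<dots> = (\<Sum>e\<in>pairs V. contr e (Poly_Mapping.lookup (frag_of \<sigma>)) \<tau>)"
      using one E finite_E
      by (intro sum.mono_neutral_left) (auto simp: contr_def)
    finally show "Poly_Mapping.lookup (simplicial_boundary r0 (frag_of \<sigma>)) \<tau> = bd (Poly_Mapping.lookup (frag_of \<sigma>)) \<tau>"
      by (simp add: bd_def sum_fun_apply)
  qed
next
  case (diff a b)
  have "Poly_Mapping.lookup (x - y) = Poly_Mapping.lookup x - Poly_Mapping.lookup y" for x y :: "'v set set \<Rightarrow>\<^sub>0 int"
    by (auto simp: fun_eq_iff lookup_minus)
  then show ?case using diff by (simp only: simplicial_boundary_diff bd_diff)
qed

text \<open>Faces with \<open>j\<close> edges have dimension \<open>j - 1\<close>. A subcomplex is given by the set \<open>E0\<close> of its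
edges, and only fillings inside the subcomplex have to be excluded.\<close>

lemma nontrivial_homology_of_chain:
  fixes z :: "'v set set \<Rightarrow> int"
  assumes E: "E0 \<subseteq> pairs V" and agree: "\<And>e f. e \<in> E0 \<Longrightarrow> f \<in> E0 \<Longrightarrow> (e, f) \<in> r \<longleftrightarrow> (e, f) \<in> r0"
    and supp: "z \<in> mchains j V" "\<And>\<sigma>. z \<sigma> \<noteq> 0 \<Longrightarrow> \<sigma> \<subseteq> E0"
    and cyc: "bd z = 0"
    and bound: "\<And>b. b \<in> mchains (Suc j) V \<Longrightarrow> (\<And>\<sigma>. b \<sigma> \<noteq> 0 \<Longrightarrow> \<sigma> \<subseteq> E0) \<Longrightarrow> bd b \<noteq> z"
  shows "\<not> trivial_group (reduced_homology_group r0 (matchings E0) (int j - 1))"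
proof (rule nontrivial_homologyI[OF simplicial_complex_matchings])
  have finE: "finite E0" using E finite_E by (rule finite_subset)
  have carrier: "c \<in> carrier (simplicial_chain_group (matchings E0) (int i - 1)) \<longleftrightarrow>
    Poly_Mapping.keys c \<subseteq> {\<sigma> \<in> Pow E0. \<sigma> \<in> matchings_of_size i V}" for c i
  proof -
    have "{\<sigma> \<in> matchings E0. finite \<sigma> \<and> int (card \<sigma>) = int i - 1 + 1} = {\<sigma> \<in> Pow E0. \<sigma> \<in> matchings_of_size i V}"
      using E finE by (auto simp: matchings_def matchings_of_size_def finite_subset)
    then show ?thesis by (simp add: simplicial_chain_group_def)
  qed
  have keys: "{\<sigma>. z \<sigma> \<noteq> 0} \<subseteq> {\<sigma> \<in> Pow E0. \<sigma> \<in> matchings_of_size j V}"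
    using supp by (auto simp: mchains_def)
  then have "finite {\<sigma>. z \<sigma> \<noteq> 0}" using finE by (elim finite_subset) auto
  then have lookup: "Poly_Mapping.lookup (Abs_poly_mapping z) = z" by (rule lookup_Abs_poly_mapping)
  then have zc: "Poly_Mapping.keys (Abs_poly_mapping z) \<subseteq> {\<sigma> \<in> Pow E0. \<sigma> \<in> matchings_of_size j V}"
    using keys by (auto simp: in_keys_iff)
  then have "Poly_Mapping.lookup (simplicial_boundary r0 (Abs_poly_mapping z)) = bd z"
    by (subst lookup_simplicial_boundary[OF E agree]) (auto simp: lookup)
  then have "simplicial_boundary r0 (Abs_poly_mapping z) = 0"
    by (intro poly_mapping_eqI) (simp add: cyc)
  then show "Abs_poly_mapping z \<in> simplicial_cycles r0 (matchings E0) (int j - 1)"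
    using zc by (simp add: simplicial_cycles_def carrier)
  show "Abs_poly_mapping z \<notin> simplicial_boundaries r0 (matchings E0) (int j - 1)"
  proof
    assume "Abs_poly_mapping z \<in> simplicial_boundaries r0 (matchings E0) (int j - 1)"
    then obtain c where c: "c \<in> carrier (simplicial_chain_group (matchings E0) (int (Suc j) - 1))"
      "Abs_poly_mapping z = simplicial_boundary r0 c"
      by (auto simp: simplicial_boundaries_def)
    then have ck: "Poly_Mapping.keys c \<subseteq> {\<sigma> \<in> Pow E0. \<sigma> \<in> matchings_of_size (Suc j) V}"
      by (simp only: carrier)
    have "z = bd (Poly_Mapping.lookup c)"
      using lookup c(2) lookup_simplicial_boundary[OF E agree, of c] ck by auto
    moreover have "Poly_Mapping.lookup c \<in> mchains (Suc j) V"
      using ck by (auto simp: mchains_def in_keys_iff)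
    moreover have "\<sigma> \<subseteq> E0" if "Poly_Mapping.lookup c \<sigma> \<noteq> 0" for \<sigma>
      using ck that by (auto simp: in_keys_iff)
    ultimately show False using bound by metis
  qed
qed

text \<open>An integral filling reduces modulo 3 to a filling over \<open>F3\<close>.\<close>

definition reduce :: "('v set set \<Rightarrow> int) \<Rightarrow> 'v set set \<Rightarrow> F3" where
  "reduce c = (\<lambda>\<sigma>. of_int (c \<sigma>))"

lemma reduce_zero: "reduce 0 = 0" and reduce_add: "reduce (c + d) = reduce c + reduce d"
  and reduce_diff: "reduce (c - d) = reduce c - reduce d"
  by (simp_all add: reduce_def fun_eq_iff)

lemma of_int_osgn: "of_int (osgn e \<sigma>) = (osgn e \<sigma> :: F3)"
  by (simp add: osgn_def)

lemma reduce_wedge: "reduce (wedge e c) = wedge e (reduce c)"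
  by (simp add: reduce_def wedge_def fun_eq_iff of_int_osgn)

lemma reduce_contr: "reduce (contr e c) = contr e (reduce c)"
  by (simp add: reduce_def contr_def fun_eq_iff of_int_osgn)

lemma reduce_sum: "reduce (\<Sum>i\<in>A. c i) = (\<Sum>i\<in>A. reduce (c i))"
  by (induction A rule: infinite_finite_induct)
     (simp_all only: sum.infinite sum.empty sum.insert reduce_zero reduce_add if_True not_False_eq_True)

lemma reduce_bd: "reduce (bd c) = bd (reduce c)"
  by (simp only: bd_def reduce_sum reduce_contr)

lemma reduce_mchains: "c \<in> mchains j S \<Longrightarrow> reduce c \<in> mchains j S"
  unfolding reduce_def mchains_def by force

lemma reduce_paths: "reduce (paths ts) = paths ts"
proof (induction ts)
  case (Cons t ts)
  obtain a b c where t: "t = (a, b, c)" by (cases t)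
  have "reduce (paths (t # ts)) = path a b c (reduce (paths ts))"
    by (simp only: t paths_Cons path_def reduce_diff reduce_wedge)
  also have "\<dots> = paths (t # ts)" by (simp only: Cons t paths_Cons)
  finally show "reduce (paths (t # ts)) = paths (t # ts)" .
qed (simp add: reduce_def empty_chain_def fun_eq_iff)

lemma reduce_hexagon: "reduce (hexagon a b c d e z) = hexagon a b c d e (reduce z)"
  by (simp add: hexagon_def reduce_add reduce_wedge)

lemma wedge_supported:
  assumes "\<And>\<sigma>. c \<sigma> \<noteq> 0 \<Longrightarrow> \<sigma> \<subseteq> E0" "e \<in> E0" "wedge e c \<sigma> \<noteq> 0"
  shows "\<sigma> \<subseteq> E0"
proof -
  have "e \<in> \<sigma>" "c (\<sigma> - {e}) \<noteq> 0" using assms(3) by (auto simp: wedge_def split: if_splits)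
  then show ?thesis using assms(1)[of "\<sigma> - {e}"] assms(2) by auto
qed

lemma paths_supported:
  fixes E0 :: "'v set set"
  shows "(\<And>a b c. (a, b, c) \<in> set ts \<Longrightarrow> {a, b} \<in> E0 \<and> {b, c} \<in> E0) \<Longrightarrow> paths ts \<sigma> \<noteq> (0 :: 'k::comm_ring_1) \<Longrightarrow> \<sigma> \<subseteq> E0"
proof (induction ts arbitrary: \<sigma>)
  case Nil
  then show ?case by (auto simp: empty_chain_def split: if_splits)
next
  case (Cons t ts)
  obtain a b c where t: "t = (a, b, c)" by (cases t)
  have "W a b (paths ts) \<sigma> \<noteq> (0 :: 'k) \<or> W b c (paths ts) \<sigma> \<noteq> (0 :: 'k)"
    using Cons.prems(2) by (auto simp: t path_def)
  moreover have "{a, b} \<in> E0" "{b, c} \<in> E0" using Cons.prems(1) by (auto simp: t)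
  moreover have "\<tau> \<subseteq> E0" if "paths ts \<tau> \<noteq> (0 :: 'k)" for \<tau>
    by (rule Cons.IH[OF _ that]) (use Cons.prems(1) in auto)
  ultimately show ?case using wedge_supported[of "paths ts :: _ \<Rightarrow> 'k"] by blast
qed

lemma hexagon_supported:
  assumes c: "\<And>\<sigma>. z \<sigma> \<noteq> 0 \<Longrightarrow> \<sigma> \<subseteq> E0"
    and e: "{a, b} \<in> E0" "{c, d} \<in> E0" "{b, e} \<in> E0" "{a, d} \<in> E0" "{b, c} \<in> E0" "{d, e} \<in> E0"
    and nz: "hexagon a b c d e z \<sigma> \<noteq> 0"
  shows "\<sigma> \<subseteq> E0"
proof (rule ccontr)
  assume out: "\<not> \<sigma> \<subseteq> E0"
  have "wedge f (wedge g z) \<sigma> = 0" if "f \<in> E0" "g \<in> E0" for f g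
    using wedge_supported[of "wedge g z" E0 f \<sigma>] wedge_supported[of z E0 g] c that out by blast
  then show False using nz e by (simp add: hexagon_def)
qed

end

section \<open>Bottom homology of matching and chessboard complexes\<close>

text \<open>There are two ways to see that a product of paths does not bound in a subcomplex: either it does not
bound even in the matching complex of all \<open>3 k + 1\<close> vertices, or there are no faces of the next
dimension.\<close>

lemma nontrivial_homology_paths:
  assumes V: "finite V" and E: "E0 \<subseteq> pairs V" and r0: "linear_order_on E0 r0"
    and ts: "distinct (path_points ts)" "set (path_points ts) \<subseteq> V"
      "\<And>a b c. (a, b, c) \<in> set ts \<Longrightarrow> {a, b} \<in> E0 \<and> {b, c} \<in> E0"
    and alt: "ts \<noteq> [] \<and> card V = 3 * length ts + 1 \<or> (\<forall>\<sigma>\<in>matchings E0. card \<sigma> \<le> length ts)"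
  shows "\<not> trivial_group (reduced_homology_group r0 (matchings E0) (int (length ts) - 1))"
proof -
  obtain r where r: "linear_order_on (pairs V) r" "\<And>x y. x \<in> E0 \<Longrightarrow> y \<in> E0 \<Longrightarrow> (x, y) \<in> r \<longleftrightarrow> (x, y) \<in> r0"
    using linear_order_extension[OF r0 E] by metis
  interpret ordered_matchings V r by unfold_locales (use V r in auto)
  show ?thesis
  proof (rule nontrivial_homology_of_chain[OF E r(2)])
    show "paths ts \<in> mchains (length ts) V" using paths_mchains[OF ts(1,2)] ts(2) by (rule mchains_mono)
    show "bd (paths ts) = 0" using bd_paths[OF ts(1,2)] .
    show "\<sigma> \<subseteq> E0" if "paths ts \<sigma> \<noteq> (0 :: int)" for \<sigma>
      by (rule paths_supported[OF ts(3) that])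
    fix b :: "'a set set \<Rightarrow> int"
    assume b: "b \<in> mchains (Suc (length ts)) V" "\<And>\<sigma>. b \<sigma> \<noteq> 0 \<Longrightarrow> \<sigma> \<subseteq> E0"
    show "bd b \<noteq> paths ts"
    proof
      assume eq: "bd b = paths ts"
      from alt show False
      proof
        assume *: "ts \<noteq> [] \<and> card V = 3 * length ts + 1"
        have "paths ts = bd (reduce b)" using reduce_bd[of b] reduce_paths[of ts] eq by simp
        then have "paths ts \<in> mbounds (length ts) V" by (rule mboundsI[OF reduce_mchains[OF b(1)]])
        then show False using essential_not_bound[OF paths_essential[of ts V]] ts * by blast
      next
        assume top: "\<forall>\<sigma>\<in>matchings E0. card \<sigma> \<le> length ts"
        have "b = 0"
        proof
          fix \<sigma>
          show "b \<sigma> = 0 \<sigma>"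
          proof (rule ccontr)
            assume "b \<sigma> \<noteq> 0 \<sigma>"
            then have s: "b \<sigma> \<noteq> 0" by simp
            then have m: "\<sigma> \<in> matchings_of_size (Suc (length ts)) V" "\<sigma> \<subseteq> E0"
              using b by (auto simp: mchains_def)
            have "finite \<sigma>" using m(1) by (auto simp: matchings_of_size_def intro: card_ge_0_finite)
            then have "\<sigma> \<in> matchings E0" using m by (simp add: matchings_of_size_def matchings_def)
            then show False using top m(1) by (auto simp: matchings_of_size_def)
          qed
        qed
        then have "paths ts = (0 :: 'a set set \<Rightarrow> int)" using eq by (simp only: bd_zero)
        then show False using paths_nonzero[OF ts(1,2)] by metis
      qed
    qed
  qed
qed

lemma nontrivial_homology_hexagon:
  assumes V: "finite V" and E: "E0 \<subseteq> pairs V" and r0: "linear_order_on E0 r0"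
    and dist: "distinct ([a, b, c, d, e] @ path_points ts)"
    and sub: "{a, b, c, d, e} \<union> set (path_points ts) \<subseteq> V" and card: "card V = 3 * length ts + 6"
    and ts: "\<And>a b c. (a, b, c) \<in> set ts \<Longrightarrow> {a, b} \<in> E0 \<and> {b, c} \<in> E0"
    and hex: "{a, b} \<in> E0" "{c, d} \<in> E0" "{b, e} \<in> E0" "{a, d} \<in> E0" "{b, c} \<in> E0" "{d, e} \<in> E0"
  shows "\<not> trivial_group (reduced_homology_group r0 (matchings E0) (int (length ts) + 1))"
proof -
  obtain r where r: "linear_order_on (pairs V) r" "\<And>x y. x \<in> E0 \<Longrightarrow> y \<in> E0 \<Longrightarrow> (x, y) \<in> r \<longleftrightarrow> (x, y) \<in> r0"
    using linear_order_extension[OF r0 E] by metis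
  interpret ordered_matchings V r by unfold_locales (use V r in auto)
  have pts: "distinct (path_points ts)" "set (path_points ts) \<subseteq> V" using dist sub by auto
  have "\<not> trivial_group (reduced_homology_group r0 (matchings E0) (int (Suc (Suc (length ts))) - 1))"
  proof (rule nontrivial_homology_of_chain[OF E r(2)])
    show "hexagon a b c d e (paths ts) \<in> mchains (Suc (Suc (length ts))) V"
      by (rule hexagon_mchains[OF paths_mchains[OF pts]]) (use dist sub in auto)
    show "bd (hexagon a b c d e (paths ts)) = 0"
      by (rule bd_hexagon[OF _ _ bd_paths[OF pts]]) (use dist sub in auto)
    show "\<sigma> \<subseteq> E0" if "hexagon a b c d e (paths ts) \<sigma> \<noteq> (0 :: int)" for \<sigma>
      by (rule hexagon_supported[OF paths_supported[OF ts] hex that])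
    fix x :: "'a set set \<Rightarrow> int"
    assume x: "x \<in> mchains (Suc (Suc (Suc (length ts)))) V"
    show "bd x \<noteq> hexagon a b c d e (paths ts)"
    proof
      assume eq: "bd x = hexagon a b c d e (paths ts)"
      have "hexagon a b c d e (paths ts) = bd (reduce x)"
        using reduce_bd[of x] reduce_paths[of ts] reduce_hexagon[of a b c d e "paths ts"] eq by simp
      then have "hexagon a b c d e (paths ts) \<in> mbounds (Suc (Suc (length ts))) V"
        by (rule mboundsI[OF reduce_mchains[OF x]])
      then show False using hexagon_not_bound[OF dist sub card] by blast
    qed
  qed
  then show ?thesis by (simp add: add.commute)
qed

lemma complete_graph_edges_pairs: "complete_graph_edges n = pairs {1..n}"
  by (simp add: complete_graph_edges_def pairs_def)

text \<open>The paths use the vertices from 1 on. Whenever one more vertex is required to apply the nonbounding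
results, the unused number 0 is added.\<close>

definition consecutive_paths :: "nat \<Rightarrow> (nat \<times> nat \<times> nat) list" where
  "consecutive_paths k = map (\<lambda>i. (3 * i + 1, 3 * i + 2, 3 * i + 3)) [0..<k]"

lemma consecutive_paths_Suc:
  "consecutive_paths (Suc k) = consecutive_paths k @ [(3 * k + 1, 3 * k + 2, 3 * k + 3)]"
  by (simp add: consecutive_paths_def)

lemma path_points_append [simp]: "path_points (xs @ ys) = path_points xs @ path_points ys"
  by (simp add: path_points_def)

lemma consecutive_paths_points:
  "distinct (path_points (consecutive_paths k)) \<and> set (path_points (consecutive_paths k)) = {1..3 * k}"
proof (induction k)
  case 0
  show ?case by (simp add: consecutive_paths_def)
next
  case (Suc k)
  have "{1..3 * Suc k} = {1..3 * k} \<union> {3 * k + 1, 3 * k + 2, 3 * k + 3}" by auto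
  then show ?case using Suc by (auto simp: consecutive_paths_Suc)
qed

lemma length_consecutive_paths [simp]: "length (consecutive_paths k) = k"
  by (simp add: consecutive_paths_def)

lemma consecutive_paths_edges:
  assumes "(a, b, c) \<in> set (consecutive_paths k)" "3 * k \<le> n"
  shows "{a, b} \<in> pairs {1..n} \<and> {b, c} \<in> pairs {1..n}"
  using assms by (auto simp: consecutive_paths_def intro!: pairsI)

lemma nu_matching_div: "nu_matching n = int ((n + 1) div 3) - 1"
  using floor_divide_of_nat_eq[of "n + 1" 3, where 'a = real] by (simp add: nu_matching_def ac_simps)

lemma nu_chessboard_div: "nu_chessboard m n = int (min m (min n ((m + n + 1) div 3))) - 1"
  using floor_divide_of_nat_eq[of "m + n + 1" 3, where 'a = real]
  by (simp add: nu_chessboard_def of_nat_min ac_simps)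

theorem matching_complex_bottom_homology:
  assumes n: "n \<ge> 3" and r: "linear_order_on (complete_graph_edges n) r"
  shows "\<not> trivial_group (reduced_homology_group r (matching_complex n) (nu_matching n))"
proof -
  define k where "k = (n + 1) div 3"
  have k: "k \<ge> 1" using n by (simp add: k_def)
  have "n = 3 * k \<or> n = 3 * k + 1 \<or> n + 1 = 3 * k" unfolding k_def by presburger
  then consider "n = 3 * k" | "n = 3 * k + 1" | "n + 1 = 3 * k" by blast
  then have "\<not> trivial_group (reduced_homology_group r (matchings (pairs {1..n})) (int k - 1))"
  proof cases
    have paths: "\<not> trivial_group (reduced_homology_group r (matchings (pairs {1..n})) (int (length (consecutive_paths k)) - 1))"
      if l: "l \<le> 1" "3 * k \<le> n" "card {l..n} = 3 * k + 1" for l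
    proof (rule nontrivial_homology_paths[of "{l..n}"])
      show "pairs {1..n} \<subseteq> pairs {l..n}" using l by (intro pairs_mono) auto
      show "linear_order_on (pairs {1..n}) r" using r by (simp add: complete_graph_edges_pairs)
      show "distinct (path_points (consecutive_paths k))" using consecutive_paths_points[of k] by simp
      show "set (path_points (consecutive_paths k)) \<subseteq> {l..n}" using consecutive_paths_points[of k] l by auto
      show "{x, y} \<in> pairs {1..n} \<and> {y, z} \<in> pairs {1..n}" if "(x, y, z) \<in> set (consecutive_paths k)" for x y z
        using that l(2) by (rule consecutive_paths_edges)
      have "consecutive_paths k \<noteq> []" using k by (simp add: consecutive_paths_def)
      then show "consecutive_paths k \<noteq> [] \<and> card {l..n} = 3 * length (consecutive_paths k) + 1
          \<or> (\<forall>\<sigma>\<in>matchings (pairs {1..n}). card \<sigma> \<le> length (consecutive_paths k))"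
        using l by simp
    qed simp
    {
      case 1
      then show ?thesis using paths[of 0] by simp
    next
      case 2
      then show ?thesis using paths[of 1] by simp
    }
  next
    case 3
    then obtain l where l: "k = Suc (Suc l)" "n = 3 * l + 5" using n by (cases k; cases "k - 1") auto
    have "\<not> trivial_group (reduced_homology_group r (matchings (pairs {1..n})) (int (length (consecutive_paths l)) + 1))"
    proof (rule nontrivial_homology_hexagon[of "{0..n}" _ _ "n - 4" "n - 3" "n - 2" "n - 1" n])
      show "pairs {1..n} \<subseteq> pairs {0..n}" by (rule pairs_mono) auto
      show "linear_order_on (pairs {1..n}) r" using r by (simp add: complete_graph_edges_pairs)
      show "card {0..n} = 3 * length (consecutive_paths l) + 6" using l by simp
      show "{x, y} \<in> pairs {1..n} \<and> {y, z} \<in> pairs {1..n}" if "(x, y, z) \<in> set (consecutive_paths l)" for x y z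
        using consecutive_paths_edges[OF that] l by simp
    qed (use l consecutive_paths_points[of l] in \<open>auto intro!: pairsI\<close>)
    then show ?thesis using l by (simp add: add.commute)
  qed
  then show ?thesis by (simp add: matching_complex_def complete_graph_edges_pairs nu_matching_div k_def)
qed

text \<open>A path on the board has its middle vertex on one side and its two ends on the other:
\<open>right_paths\<close> use one left and two right vertices each, \<open>left_paths\<close> two left and one right vertex.
With \<open>b\<close> and \<open>a\<close> of them, exactly the first \<open>b + 2 a\<close> left and \<open>2 b + a\<close> right vertices are
covered.\<close>

definition right_paths :: "nat \<Rightarrow> ((nat + nat) \<times> (nat + nat) \<times> (nat + nat)) list" where
  "right_paths b = map (\<lambda>i. (Inr (2 * i + 1), Inl (i + 1), Inr (2 * i + 2))) [0..<b]"

definition left_paths :: "nat \<Rightarrow> nat \<Rightarrow> ((nat + nat) \<times> (nat + nat) \<times> (nat + nat)) list" where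
  "left_paths b a = map (\<lambda>i. (Inl (b + 2 * i + 1), Inr (2 * b + i + 1), Inl (b + 2 * i + 2))) [0..<a]"

definition chess_paths :: "nat \<Rightarrow> nat \<Rightarrow> ((nat + nat) \<times> (nat + nat) \<times> (nat + nat)) list" where
  "chess_paths b a = right_paths b @ left_paths b a"

lemma right_paths_points:
  "distinct (path_points (right_paths b)) \<and> set (path_points (right_paths b)) = Inl ` {1..b} \<union> Inr ` {1..2 * b}"
proof (induction b)
  case 0
  show ?case by (simp add: right_paths_def)
next
  case (Suc b)
  have 1: "right_paths (Suc b) = right_paths b @ [(Inr (2 * b + 1), Inl (b + 1), Inr (2 * b + 2))]"
    by (simp add: right_paths_def)
  have "{1..Suc b} = {1..b} \<union> {b + 1}" "{1..2 * Suc b} = {1..2 * b} \<union> {2 * b + 1, 2 * b + 2}" by auto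
  then show ?case using Suc by (auto simp: 1)
qed

lemma left_paths_points:
  "distinct (path_points (left_paths b a)) \<and>
    set (path_points (left_paths b a)) = Inl ` {b + 1..b + 2 * a} \<union> Inr ` {2 * b + 1..2 * b + a}"
proof (induction a)
  case 0
  show ?case by (simp add: left_paths_def)
next
  case (Suc a)
  have 1: "left_paths b (Suc a) = left_paths b a @ [(Inl (b + 2 * a + 1), Inr (2 * b + a + 1), Inl (b + 2 * a + 2))]"
    by (simp add: left_paths_def)
  have "{b + 1..b + 2 * Suc a} = {b + 1..b + 2 * a} \<union> {b + 2 * a + 1, b + 2 * a + 2}"
    "{2 * b + 1..2 * b + Suc a} = {2 * b + 1..2 * b + a} \<union> {2 * b + a + 1}" by auto
  then show ?case using Suc by (auto simp: 1)
qed

lemma chess_paths_points: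
  "distinct (path_points (chess_paths b a))"
  "set (path_points (chess_paths b a)) = Inl ` {1..b + 2 * a} \<union> Inr ` {1..2 * b + a}"
proof -
  note pts = right_paths_points[of b] left_paths_points[of b a]
  have "{1..b + 2 * a} = {1..b} \<union> {b + 1..b + 2 * a}" "{1..2 * b + a} = {1..2 * b} \<union> {2 * b + 1..2 * b + a}"
    by auto
  then show "set (path_points (chess_paths b a)) = Inl ` {1..b + 2 * a} \<union> Inr ` {1..2 * b + a}"
    using pts by (simp only: chess_paths_def path_points_append set_append image_Un Un_ac)
  show "distinct (path_points (chess_paths b a))"
    using pts by (auto simp: chess_paths_def)
qed

lemma length_chess_paths [simp]: "length (chess_paths b a) = b + a"
  by (simp add: chess_paths_def right_paths_def left_paths_def)

lemma bipartite_edgeI: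
  "i \<in> {1..m} \<Longrightarrow> j \<in> {1..n} \<Longrightarrow> {Inl i, Inr j} \<in> complete_bipartite_edges m n"
  "i \<in> {1..m} \<Longrightarrow> j \<in> {1..n} \<Longrightarrow> {Inr j, Inl i} \<in> complete_bipartite_edges m n"
  by (auto simp: complete_bipartite_edges_def)

lemma chess_paths_edges:
  assumes "(x, y, z) \<in> set (chess_paths b a)" "b + 2 * a \<le> m" "2 * b + a \<le> n"
  shows "{x, y} \<in> complete_bipartite_edges m n \<and> {y, z} \<in> complete_bipartite_edges m n"
  using assms by (auto simp: chess_paths_def right_paths_def left_paths_def intro!: bipartite_edgeI)

lemma bipartite_edges_pairs:
  "complete_bipartite_edges m n \<subseteq> pairs (Inl ` {l..m} \<union> Inr ` {1..n})" if "l \<le> 1"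
  using that by (auto simp: complete_bipartite_edges_def intro!: pairsI)

lemma card_vertices: "card (Inl ` {l..m} \<union> Inr ` {1..n} :: (nat + nat) set) = Suc m - l + n"
  by (subst card_Un_disjoint) (auto simp: card_image)

lemma card_bipartite_matching:
  assumes "\<sigma> \<in> matchings (complete_bipartite_edges m n)"
  shows "card \<sigma> \<le> m" "card \<sigma> \<le> n"
proof -
  have E: "\<sigma> \<subseteq> complete_bipartite_edges m n" and dis: "pairwise disjnt \<sigma>"
    using assms by (auto simp: matchings_def)
  have "\<forall>e\<in>\<sigma>. \<exists>i j. i \<in> {1..m} \<and> j \<in> {1..n} \<and> e = {Inl i, Inr j}"
    using E unfolding complete_bipartite_edges_def by blast
  then obtain f g where fg: "\<And>e. e \<in> \<sigma> \<Longrightarrow> f e \<in> {1..m} \<and> g e \<in> {1..n} \<and> e = {Inl (f e), Inr (g e)}"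
    by metis
  have same: "e = e'" if "e \<in> \<sigma>" "e' \<in> \<sigma>" "e \<inter> e' \<noteq> {}" for e e'
    using dis that unfolding pairwise_def disjnt_def by blast
  have "inj_on f \<sigma>"
  proof (rule inj_onI)
    fix e e' assume e: "e \<in> \<sigma>" "e' \<in> \<sigma>" "f e = f e'"
    then have "Inl (f e) \<in> e \<inter> e'" using fg[of e] fg[of e'] by (metis IntI insertI1)
    then show "e = e'" using same[OF e(1,2)] by blast
  qed
  then have "card \<sigma> \<le> card {1..m}" by (rule card_inj_on_le) (use fg in auto)
  then show "card \<sigma> \<le> m" by simp
  have "inj_on g \<sigma>"
  proof (rule inj_onI)
    fix e e' assume e: "e \<in> \<sigma>" "e' \<in> \<sigma>" "g e = g e'"
    then have "Inr (g e) \<in> e \<inter> e'" using fg[of e] fg[of e'] by (metis IntI insertI1 insertI2)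
    then show "e = e'" using same[OF e(1,2)] by blast
  qed
  then have "card \<sigma> \<le> card {1..n}" by (rule card_inj_on_le) (use fg in auto)
  then show "card \<sigma> \<le> n" by simp
qed

text \<open>If one side is at least twice as long as the other, paths centred on the shorter side give a cycle
of top dimension. Otherwise the numbers \<open>b\<close> and \<open>a\<close> of paths of the two kinds are determined by
covering all vertices, except for one left vertex if \<open>m + n = 3 k + 1\<close> and except for the five vertices
of a hexagon if \<open>m + n = 3 k - 1\<close>; in that last case the hexagon has two left vertices unless
\<open>m = 2 n - 1\<close>, when it must have three.\<close>

theorem chessboard_complex_bottom_homology:
  assumes mn: "m \<ge> 1" "n \<ge> 1" "m + n \<ge> 3" and r: "linear_order_on (complete_bipartite_edges m n) r"
  shows "\<not> trivial_group (reduced_homology_group r (chessboard_complex m n) (nu_chessboard m n))"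
proof -
  define k where "k = (m + n + 1) div 3"
  let ?E = "complete_bipartite_edges m n"
  let ?V = "\<lambda>l. Inl ` {l..m} \<union> Inr ` {1..n} :: (nat + nat) set"
  have paths: "\<not> trivial_group (reduced_homology_group r (matchings ?E) (int (b + a) - 1))"
    if ba: "b + 2 * a \<le> m" "2 * b + a \<le> n" and l: "l \<le> 1"
      and alt: "b + a \<noteq> 0 \<and> Suc m - l + n = 3 * (b + a) + 1 \<or> b + a = m \<or> b + a = n" for a b l
  proof -
    have "\<not> trivial_group (reduced_homology_group r (matchings ?E) (int (length (chess_paths b a)) - 1))"
    proof (rule nontrivial_homology_paths[of "?V l"])
      show "?E \<subseteq> pairs (?V l)" using l by (rule bipartite_edges_pairs)
      show "distinct (path_points (chess_paths b a))" by (rule chess_paths_points)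
      show "set (path_points (chess_paths b a)) \<subseteq> ?V l"
        unfolding chess_paths_points(2) using ba l by auto
      show "{x, y} \<in> ?E \<and> {y, z} \<in> ?E" if "(x, y, z) \<in> set (chess_paths b a)" for x y z
        using that ba by (rule chess_paths_edges)
      show "chess_paths b a \<noteq> [] \<and> card (?V l) = 3 * length (chess_paths b a) + 1
          \<or> (\<forall>\<sigma>\<in>matchings ?E. card \<sigma> \<le> length (chess_paths b a))"
        unfolding card_vertices length_chess_paths
        using alt card_bipartite_matching[of _ m n] length_chess_paths[of b a] by (metis length_0_conv)
    qed (use r in auto)
    then show ?thesis by simp
  qed
  have hex: "\<not> trivial_group (reduced_homology_group r (matchings ?E) (int (b + a) + 1))"
    if ba: "b + 2 * a + 2 = m \<and> 2 * b + a + 3 = n \<or> b + 2 * a + 3 = m \<and> 2 * b + a + 2 = n" for a b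
    using ba
  proof
    assume *: "b + 2 * a + 2 = m \<and> 2 * b + a + 3 = n"
    have "\<not> trivial_group (reduced_homology_group r (matchings ?E) (int (length (chess_paths b a)) + 1))"
    proof (rule nontrivial_homology_hexagon[of "?V 0" _ _ "Inr (n - 2)" "Inl (m - 1)" "Inr (n - 1)" "Inl m" "Inr n"])
      show "?E \<subseteq> pairs (?V 0)" by (rule bipartite_edges_pairs) simp
      show "card (?V 0) = 3 * length (chess_paths b a) + 6"
        unfolding card_vertices using * by simp
      show "{x, y} \<in> ?E \<and> {y, z} \<in> ?E" if "(x, y, z) \<in> set (chess_paths b a)" for x y z
        by (rule chess_paths_edges[OF that]) (use * in auto)
      show "distinct ([Inr (n - 2), Inl (m - 1), Inr (n - 1), Inl m, Inr n] @ path_points (chess_paths b a))"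
        using * chess_paths_points[of b a] by auto
      show "{Inr (n - 2), Inl (m - 1), Inr (n - 1), Inl m, Inr n} \<union> set (path_points (chess_paths b a)) \<subseteq> ?V 0"
        unfolding chess_paths_points(2) using * by auto
    qed (use r * in \<open>auto intro!: bipartite_edgeI\<close>)
    then show ?thesis by simp
  next
    assume *: "b + 2 * a + 3 = m \<and> 2 * b + a + 2 = n"
    have "\<not> trivial_group (reduced_homology_group r (matchings ?E) (int (length (chess_paths b a)) + 1))"
    proof (rule nontrivial_homology_hexagon[of "?V 0" _ _ "Inl (m - 2)" "Inr (n - 1)" "Inl (m - 1)" "Inr n" "Inl m"])
      show "?E \<subseteq> pairs (?V 0)" by (rule bipartite_edges_pairs) simp
      show "card (?V 0) = 3 * length (chess_paths b a) + 6"
        unfolding card_vertices using * by simp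
      show "{x, y} \<in> ?E \<and> {y, z} \<in> ?E" if "(x, y, z) \<in> set (chess_paths b a)" for x y z
        by (rule chess_paths_edges[OF that]) (use * in auto)
      show "distinct ([Inl (m - 2), Inr (n - 1), Inl (m - 1), Inr n, Inl m] @ path_points (chess_paths b a))"
        using * chess_paths_points[of b a] by auto
      show "{Inl (m - 2), Inr (n - 1), Inl (m - 1), Inr n, Inl m} \<union> set (path_points (chess_paths b a)) \<subseteq> ?V 0"
        unfolding chess_paths_points(2) using * by auto
    qed (use r * in \<open>auto intro!: bipartite_edgeI\<close>)
    then show ?thesis by simp
  qed
  have k: "m + n = 3 * k \<or> m + n = 3 * k + 1 \<or> m + n + 1 = 3 * k" unfolding k_def by presburger
  have "\<not> trivial_group (reduced_homology_group r (matchings ?E) (int (min m (min n k)) - 1))"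
  proof -
    consider "n \<ge> 2 * m" | "m \<ge> 2 * n" | "n < 2 * m" "m < 2 * n" by linarith
    then show ?thesis
    proof cases
      case 1
      then have "min m (min n k) = m" using k mn by auto
      then show ?thesis using paths[of m 0 0] 1 by simp
    next
      case 2
      then have "min m (min n k) = n" using k mn by auto
      then show ?thesis using paths[of 0 n 0] 2 by simp
    next
      case 3
      then have min: "min m (min n k) = k" using k by auto
      from k consider "m + n = 3 * k" | "m + n = 3 * k + 1" | "m + n + 1 = 3 * k" by blast
      then show ?thesis
      proof cases
        case 1
        then have "m \<ge> k" "n \<ge> k" "k = (n - k) + (m - k)" using 3 by linarith+
        then show ?thesis unfolding min using paths[of "n - k" "m - k" 0] 1 3 mn by auto
      next
        case 2
        then have "m \<ge> k + 1" "n \<ge> k" "k = (n - k) + (m - k - 1)" using 3 by linarith+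
        then show ?thesis unfolding min using paths[of "n - k" "m - k - 1" 1] 2 3 mn by auto
      next
        case c: 3
        show ?thesis
        proof (cases "m + 1 = 2 * n")
          case True
          then have "k = n" "n \<ge> 2" using c mn by simp_all
          then have "0 + 2 * (n - 2) + 3 = m \<and> 2 * 0 + (n - 2) + 2 = n" using True by linarith
          with hex[of 0 "n - 2"] have "\<not> trivial_group (reduced_homology_group r (matchings ?E) (int (0 + (n - 2)) + 1))"
            by blast
          moreover have "int (0 + (n - 2)) + 1 = int k - 1" using \<open>k = n\<close> \<open>n \<ge> 2\<close> by simp
          ultimately show ?thesis unfolding min by (simp only: not_False_eq_True)
        next
          case False
          then have "m \<ge> k" "n \<ge> k + 1" using c 3 by presburger+
          then obtain x y where xy: "m = k + x" "n = k + 1 + y"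
            by (auto simp: le_iff_add)
          then have k: "x + y + 2 = k" using c by linarith
          then have "y + 2 * x + 2 = m \<and> 2 * y + x + 3 = n" using xy by linarith
          with hex[of y x]
          have "\<not> trivial_group (reduced_homology_group r (matchings ?E) (int (y + x) + 1))"
            by blast
          moreover have "int (y + x) + 1 = int k - 1" using k by linarith
          ultimately show ?thesis unfolding min by (simp only: not_False_eq_True)
        qed
      qed
    qed
  qed
  then show ?thesis by (simp add: chessboard_complex_def nu_chessboard_div k_def)
qed

theorem theorem3p1:
  shows "(\<forall>n::nat. n \<ge> 3 \<longrightarrow>
           (\<forall>r. linear_order_on (complete_graph_edges n) r \<longrightarrow>
             \<not> trivial_group (reduced_homology_group r (matching_complex n) (nu_matching n)))) \<and>
         (\<forall>m n::nat. m \<ge> 1 \<longrightarrow> n \<ge> 1 \<longrightarrow> m + n \<ge> 3 \<longrightarrow>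
           (\<forall>r. linear_order_on (complete_bipartite_edges m n) r \<longrightarrow>
             \<not> trivial_group (reduced_homology_group r (chessboard_complex m n) (nu_chessboard m n))))"
  using matching_complex_bottom_homology chessboard_complex_bottom_homology by blast

end
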